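(* Let $X$ be a Banach space. For every integer $n\ge1$, every $N>1$, and every compact set $\mathcal K\subset X$ with $\sup_{f\in\mathcal K}\|f\|_X=1$, $$d^{2(N+1)\sqrt n}_{n+1}(\mathcal K)_X\le d_n(\mathcal K,N)_X\qquad\text{and}\qquad d^{6\sqrt n}_{n+\lceil\log_2N\rceil}(\mathcal K)_X\le d_n(\mathcal K,N)_X.$$ When $X=L_p$, $$d^{2(N+1)n^{|1/2-1/p|}}_{n+1}(\mathcal K)_{L_p}\le d_n(\mathcal K,N)_{L_p}\qquad\text{and}\qquad d^{6n^{|1/2-1/p|}}_{n+\lceil\log_2N\rceil}(\mathcal K)_{L_p}\le d_n(\mathcal K,N)_{L_p}.$$ Here the superscripts are the Lipschitz constants of the Lipschitz widths.
   Context: All linear spaces are over the real numbers; $L_p$ denotes a Banach space $L_p$, $1\le p\le\infty$ (with $1/\infty=0$). Let $X$ be a Banach space and $\mathcal K\subset X$ compact. Nonlinear Kolmogorov $(n,N)$-width, $N\ge1$ real, $n\ge1$: $$d_n(\mathcal K,N)_X=\inf_{\mathcal L_N}\ \sup_{f\in\mathcal K}\ \inf_{X_n\in\mathcal L_N}\operatorname{dist}(f,X_n)_X,$$ where the outer infimum is over all sets $\mathcal L_N$ of at most $N$ linear subspaces $X_n\subset X$ of dimension $n$. Lipschitz width: for a norm $\|\cdot\|_{Y_k}$ on $\mathbb R^k$, $k\ge 1$, let $B_{Y_k}=\{y\in\mathbb R^k:\|y\|_{Y_k}\le1\}$. For $\gamma\ge0$ let $$d^\gamma(\mathcal K,Y_k)_X=\inf_{\Phi_k}\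 \sup_{f\in\mathcal K}\ \inf_{y\in B_{Y_k}}\|f-\Phi_k(y)\|_X,$$ where the infimum is over all maps $\Phi_k:B_{Y_k}\to X$ with $\|\Phi_k(y)-\Phi_k(y')\|_X\le\gamma\|y-y'\|_{Y_k}$ for all $y,y'\in B_{Y_k}$. Then $$d_n^\gamma(\mathcal K)_X=\inf_{k\le n}\ \inf_{\|\cdot\|_{Y_k}}d^\gamma(\mathcal K,Y_k)_X,$$ the infimum being over all $1\le k\le n$ and all norms $\|\cdot\|_{Y_k}$ on $\mathbb R^k$. *)

theory Defs
  imports "HOL-Analysis.Analysis" "HOL-Probability.Essential_Supremum"
begin

section \<open>Nonlinear Kolmogorov width\<close>

text \<open>
  Widths take values in \<^typ>\<open>ennreal\<close>, so that an infimum over an empty family is \<open>\<infinity>\<close>; in particular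
  the width of a nonempty set is \<open>\<infinity>\<close> if the space has no subspace of dimension \<open>n\<close>.
  Since \<^const>\<open>dim\<close> is \<open>0\<close> on infinite-dimensional subspaces, the condition \<^prop>\<open>dim V = n\<close> only
  expresses that \<open>V\<close> is finite-dimensional of dimension \<open>n\<close> when \<^prop>\<open>n \<ge> 1\<close>, the only case of
  interest.
\<close>

definition kolmogorov_width :: "nat \<Rightarrow> real \<Rightarrow> 'a::real_normed_vector set \<Rightarrow> ennreal" where
  "kolmogorov_width n N K =
     (INF L \<in> {L :: 'a set set. finite L \<and> real (card L) \<le> N \<and> (\<forall>V\<in>L. subspace V \<and> dim V = n)}.
        SUP f\<in>K. INF V\<in>L. ennreal (infdist f V))"

section \<open>Lipschitz width\<close>

text \<open>
  The dimension \<open>k\<close> varies inside the definition of the width, so \<open>\<real>\<^sup>k\<close> is rendered as the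
  set of all \<open>y :: nat \<Rightarrow> real\<close> supported on the indices \<open>0, \<dots>, k - 1\<close>; this is also the carrier of
  \<^term>\<open>Euclidean_space k\<close>.
\<close>

definition Rk :: "nat \<Rightarrow> (nat \<Rightarrow> real) set" where
  "Rk k = {y. \<forall>i\<ge>k. y i = 0}"

text \<open>The values of \<open>\<nu>\<close> outside \<^term>\<open>Rk k\<close> are irrelevant.\<close>

definition norm_on_Rk :: "nat \<Rightarrow> ((nat \<Rightarrow> real) \<Rightarrow> real) \<Rightarrow> bool" where
  "norm_on_Rk k \<nu> \<longleftrightarrow>
     (\<forall>y\<in>Rk k. 0 \<le> \<nu> y \<and> (\<nu> y = 0 \<longleftrightarrow> y = (\<lambda>i. 0))) \<and>
     (\<forall>y\<in>Rk k. \<forall>c. \<nu> (\<lambda>i. c * y i) = \<bar>c\<bar> * \<nu> y) \<and>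
     (\<forall>y\<in>Rk k. \<forall>z\<in>Rk k. \<nu> (\<lambda>i. y i + z i) \<le> \<nu> y + \<nu> z)"

definition unit_ball_Rk :: "nat \<Rightarrow> ((nat \<Rightarrow> real) \<Rightarrow> real) \<Rightarrow> (nat \<Rightarrow> real) set" where
  "unit_ball_Rk k \<nu> = {y \<in> Rk k. \<nu> y \<le> 1}"

definition lipschitz_maps ::
  "real \<Rightarrow> nat \<Rightarrow> ((nat \<Rightarrow> real) \<Rightarrow> real) \<Rightarrow> ((nat \<Rightarrow> real) \<Rightarrow> 'a::real_normed_vector) set" where
  "lipschitz_maps \<gamma> k \<nu> =
     {\<Phi>. \<forall>y\<in>unit_ball_Rk k \<nu>. \<forall>y'\<in>unit_ball_Rk k \<nu>.
           norm (\<Phi> y - \<Phi> y') \<le> \<gamma> * \<nu> (\<lambda>i. y i - y' i)}"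

definition fixed_lipschitz_width ::
  "real \<Rightarrow> nat \<Rightarrow> ((nat \<Rightarrow> real) \<Rightarrow> real) \<Rightarrow> 'a::real_normed_vector set \<Rightarrow> ennreal" where
  "fixed_lipschitz_width \<gamma> k \<nu> K =
     (INF \<Phi> \<in> lipschitz_maps \<gamma> k \<nu>. SUP f\<in>K. INF y\<in>unit_ball_Rk k \<nu>. ennreal (norm (f - \<Phi> y)))"

definition lipschitz_width :: "real \<Rightarrow> nat \<Rightarrow> 'a::real_normed_vector set \<Rightarrow> ennreal" where
  "lipschitz_width \<gamma> n K =
     (INF k\<in>{1..n}. INF \<nu>\<in>{\<nu>. norm_on_Rk k \<nu>}. fixed_lipschitz_width \<gamma> k \<nu> K)"

section \<open>Lebesgue spaces\<close>

definition Lp_functions :: "ennreal \<Rightarrow> 'b measure \<Rightarrow> ('b \<Rightarrow> real) set" where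
  "Lp_functions p M =
     {f \<in> borel_measurable M.
        if p = \<infinity> then esssup M (\<lambda>t. ennreal \<bar>f t\<bar>) < \<infinity>
        else integrable M (\<lambda>t. \<bar>f t\<bar> powr enn2real p)}"

definition Lp_norm :: "ennreal \<Rightarrow> 'b measure \<Rightarrow> ('b \<Rightarrow> real) \<Rightarrow> real" where
  "Lp_norm p M f =
     (if p = \<infinity> then enn2real (esssup M (\<lambda>t. ennreal \<bar>f t\<bar>))
      else (LINT t|M. \<bar>f t\<bar> powr enn2real p) powr (1 / enn2real p))"

text \<open>
  A type cannot depend on the measure \<open>M\<close>, so ``\<open>X = L\<^sub>p(M)\<close>'' is expressed for a normed
  space type by a map \<open>J\<close> choosing for every \<open>x\<close> a representative \<open>J x\<close> of the corresponding class
  of functions modulo equality almost everywhere. The conditions say that \<open>x \<mapsto> [J x]\<close> is a linear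
  isometry onto \<open>L\<^sub>p(M)\<close>; it is injective because it preserves norms.
\<close>

definition is_Lp_space ::
  "ennreal \<Rightarrow> 'b measure \<Rightarrow> ('a::real_normed_vector \<Rightarrow> 'b \<Rightarrow> real) \<Rightarrow> bool" where
  "is_Lp_space p M J \<longleftrightarrow>
     (\<forall>x. J x \<in> Lp_functions p M) \<and>
     (\<forall>x y. AE t in M. J (x + y) t = J x t + J y t) \<and>
     (\<forall>c x. AE t in M. J (c *\<^sub>R x) t = c * J x t) \<and>
     (\<forall>x. norm x = Lp_norm p M (J x)) \<and>
     (\<forall>f\<in>Lp_functions p M. \<exists>x. AE t in M. J x t = f t)"

text \<open>\<open>\<bar>1/2 - 1/p\<bar>\<close>, with \<open>1/\<infinity> = 0\<close> already in \<^typ>\<open>ennreal\<close>.\<close>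

definition Lp_exponent :: "ennreal \<Rightarrow> real" where
  "Lp_exponent p = \<bar>1 / 2 - enn2real (1 / p)\<bar>"

end

theory Submission
  imports Defs "Jordan_Normal_Form.Determinant"
begin

text \<open>
  Let \<open>V\<close> be an \<open>n\<close>-dimensional subspace, and suppose that a linear map \<open>T\<close> from Euclidean \<open>\<real>\<^sup>n\<close>
  to the space satisfies \<open>\<parallel>T a\<parallel> \<le> |a|\<close>, while every \<open>x \<in> V\<close> has a preimage with \<open>|a| \<le> D \<parallel>x\<parallel>\<close>
  (\<open>euclidean_frame\<close>). Then \<open>y \<mapsto> 2D T y\<close> maps the Euclidean unit ball onto a set containing
  all elements of \<open>V\<close> of norm at most \<open>2\<close>, and these suffice to approximate an \<open>f\<close> with
  \<open>\<parallel>f\<parallel> \<le> 1\<close> almost as well as all of \<open>V\<close> does. To serve finitely many subspaces with one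
  Lipschitz map, further coordinates \<open>t\<close>, measured in the maximum norm, select the subspace: the
  map is \<open>(y, t) \<mapsto> \<Sum>\<^sub>V h\<^sub>V(t) 2D T\<^sub>V y\<close> with hat functions \<open>h\<^sub>V\<close> of slope \<open>s\<close>
  centred at points \<open>t\<^sub>V\<close> of mutual distance at least \<open>2/s\<close>. The hats have disjoint supports
  and their total variation is at most \<open>s\<close> times the distance, so the Lipschitz constant is
  \<open>2D(1 + s)\<close> (\<open>lipschitz_width_le_glued\<close>). On the interval \<open>[-1, 1]\<close> there is room for \<open>N\<close> points
  with \<open>s = N\<close>; the cube of dimension \<open>\<lceil>log\<^sub>2 N\<rceil>\<close> has at least \<open>N\<close> corners, and \<open>s = 1\<close>,
  which gives \<open>4D \<le> 6D\<close>.

  It remains to find \<open>D\<close>. By John's theorem \<open>D = \<surd>n\<close> is possible in every normed space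
  (\<open>john_euclidean_frame\<close>), by Lewis's theorem \<open>D = n\<^bsup>|1/2 - 1/p|\<^esup>\<close> in \<open>L\<^sub>p\<close> for \<open>p < \<infinity>\<close>
  (\<open>lewis_euclidean_frame\<close>); for \<open>p = \<infinity>\<close> the two numbers agree and John's theorem applies.
  Both theorems come from one variational principle (\<open>extremal_basis\<close>): for a norm \<open>\<alpha>\<close> on
  \<open>n\<close>-tuples, \<open>V\<close> has a basis \<open>v\<close> of largest determinant relative to \<open>\<alpha>\<close>, that is,
  \<open>det P \<sqdot> \<alpha>(v)\<^sup>n \<le> \<alpha>(P v)\<^sup>n\<close> for all matrices \<open>P\<close>. Since the derivative of
  \<open>det (I + s B)\<close> at \<open>s = 0\<close> is the trace of \<open>B\<close>, perturbing \<open>v\<close> yields first-order conditions.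
  When \<open>\<alpha>\<close> is the operator norm of \<open>a \<mapsto> \<Sum>\<^sub>i a\<^sub>i v\<^sub>i\<close>, the perturbation \<open>B = w w\<^sup>T - I\<close> rules
  out a \<open>w\<close> with \<open>|w|\<^sup>2 > n\<close> and \<open>\<parallel>T w\<parallel> \<le> 1\<close>. When \<open>\<alpha>\<close> is the \<open>L\<^sub>p\<close>-norm of the square
  function \<open>F = (\<Sum>\<^sub>i v\<^sub>i\<^sup>2)\<^bsup>1/2\<^esup>\<close>, elementary matrices \<open>B\<close> show that the \<open>v\<^sub>i\<close> are orthogonal
  with respect to the weight \<open>F\<^bsup>p-2\<^esup>\<close>, and Hoelder's inequality compares the two norms.
\<close>

section \<open>Determinants of matrices of variable size\<close>

text \<open>
  The dimension \<open>n\<close> is a term, so a matrix is given by its entries, and only those with both indices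
  below \<open>n\<close> count. As a function of the entries the determinant lives on a product space, whose
  topology is needed below.
\<close>

definition mdet :: "nat \<Rightarrow> (nat \<times> nat \<Rightarrow> real) \<Rightarrow> real" where
  "mdet n P = Determinant.det (mat n n P)"

lemma mdet_leibniz:
  "mdet n P = (\<Sum>p | p permutes {0..<n}. signof p * (\<Prod>i = 0..<n. P (i, p i)))"
proof -
  have "P (i, p i) = mat n n P $$ (i, p i)" if "p permutes {0..<n}" "i < n" for p i
    using that permutes_in_image[of p "{0..<n}" i] by auto
  then show ?thesis
    unfolding mdet_def Determinant.det_def
    by (auto intro!: sum.cong prod.cong)
qed

lemma mdet_mult:
  "mdet n (\<lambda>(i, j). \<Sum>k<n. P (i, k) * C (k, j)) = mdet n P * mdet n C"
proof -
  have "mat n n (\<lambda>(i, j). \<Sum>k<n. P (i, k) * C (k, j)) = mat n n P * mat n n C"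
    by (rule eq_matI) (auto simp: scalar_prod_def lessThan_atLeast0)
  then show ?thesis
    unfolding mdet_def by (simp add: Determinant.det_mult[of _ n])
qed

lemma mdet_identity: "mdet n (\<lambda>(i, j). if i = j then 1 else 0) = 1"
proof -
  have "mat n n (\<lambda>(i, j). if i = j then 1 else 0) = (1\<^sub>m n :: real mat)"
    by (rule eq_matI) auto
  then show ?thesis
    unfolding mdet_def by simp
qed

lemma mdet_zero:
  assumes "n \<ge> 1" "\<And>i j. i < n \<Longrightarrow> j < n \<Longrightarrow> P (i, j) = 0"
  shows "mdet n P = 0"
proof -
  have "mat n n P = 0\<^sub>m n n"
    by (rule eq_matI) (auto simp: assms)
  then show ?thesis
    using assms(1) unfolding mdet_def by simp
qed

lemma mdet_scale: "mdet n (\<lambda>x. c * P x) = c ^ n * mdet n P"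
  by (simp add: mdet_leibniz prod.distrib sum_distrib_left mult.left_commute)

lemma mdet_left_inverse:
  assumes "mdet n C \<noteq> 0"
  shows "\<exists>W. \<forall>i<n. \<forall>j<n. (\<Sum>k<n. W (i, k) * C (k, j)) = (if i = j then 1 else 0)"
proof -
  define A where "A = mat n n C"
  have A: "A \<in> carrier_mat n n"
    by (simp add: A_def)
  define W where "W = (\<lambda>x. adj_mat A $$ x / mdet n C)"
  have "(\<Sum>k<n. W (i, k) * C (k, j)) = (if i = j then 1 else 0)" if ij: "i < n" "j < n" for i j
  proof -
    have "(adj_mat A * A) $$ (i, j) = (\<Sum>k<n. adj_mat A $$ (i, k) * C (k, j))"
      using ij adj_mat(1)[OF A] A by (auto simp: scalar_prod_def lessThan_atLeast0 A_def)
    then have "(\<Sum>k<n. adj_mat A $$ (i, k) * C (k, j)) = (mdet n C \<cdot>\<^sub>m 1\<^sub>m n) $$ (i, j)"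
      using adj_mat(3)[OF A] by (simp add: mdet_def A_def)
    then show ?thesis
      using ij assms by (simp add: W_def flip: sum_divide_distrib)
  qed
  then show ?thesis
    by (intro exI[of _ W]) blast
qed

lemma continuous_on_mdet: "continuous_on S (mdet n)"
  unfolding mdet_leibniz
  by (intro continuous_intros continuous_on_subset[OF continuous_on_product_coordinates subset_UNIV])

text \<open>
  In the Leibniz expansion every permutation other than the identity moves at least two indices, so
  its product has two factors that vanish at \<open>s = 0\<close> and contributes nothing to first order.
\<close>

lemma mdet_derivative_at_identity:
  "((\<lambda>s. mdet n (\<lambda>(i, j). (if i = j then 1 else 0) + s * B (i, j)))
     has_real_derivative (\<Sum>i<n. B (i, i))) (at 0)"
proof -
  define \<delta> :: "nat \<Rightarrow> nat \<Rightarrow> real" where "\<delta> i j = (if i = j then 1 else 0)" for i j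
  define D where "D p = signof p * (\<Sum>i = 0..<n. B (i, p i) * (\<Prod>j\<in>{0..<n} - {i}. \<delta> j (p j)))"
    for p
  have der: "((\<lambda>s. \<Sum>p | p permutes {0..<n}. signof p * (\<Prod>i = 0..<n. \<delta> i (p i) + s * B (i, p i)))
      has_real_derivative (\<Sum>p | p permutes {0..<n}. D p)) (at 0)"
  proof (rule DERIV_sum)
    fix p
    have "((\<lambda>s. \<Prod>i = 0..<n. \<delta> i (p i) + s * B (i, p i)) has_real_derivative
        (\<Sum>i = 0..<n. B (i, p i) * (\<Prod>j\<in>{0..<n} - {i}. \<delta> j (p j) + 0 * B (j, p j)))) (at 0)"
      by (rule has_field_derivative_prod) (auto intro!: derivative_eq_intros)
    then show "((\<lambda>s. signof p * (\<Prod>i = 0..<n. \<delta> i (p i) + s * B (i, p i)))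
        has_real_derivative D p) (at 0)"
      unfolding D_def by (intro DERIV_cmult) simp
  qed
  \<comment> \<open>If \<open>p\<close> moved no index besides \<open>i\<close>, then it would fix \<open>i\<close> as well.\<close>
  have "D p = 0" if p: "p permutes {0..<n}" "p \<noteq> id" for p
  proof -
    have "\<exists>j\<in>{0..<n} - {i}. \<delta> j (p j) = 0" if i: "i < n" for i
    proof (rule ccontr)
      assume "\<not> ?thesis"
      then have fix_other: "p j = j" if "j \<noteq> i" for j
        using that permutes_not_in[OF p(1), of j] by (cases "j < n") (auto simp: \<delta>_def split: if_splits)
      moreover have "p i = i"
        using fix_other[of "p i"] permutes_inj[OF p(1)] by (metis injD)
      ultimately show False
        using p(2) by (metis eq_id_iff)
    qed
    then have "(\<Prod>j\<in>{0..<n} - {i}. \<delta> j (p j)) = 0" if "i < n" for i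
      using that by (metis finite_Diff finite_atLeastLessThan prod_zero)
    then show ?thesis
      by (auto simp: D_def intro!: sum.neutral simp del: prod_zero_iff)
  qed
  moreover have "D id = (\<Sum>i<n. B (i, i))"
    by (simp add: D_def \<delta>_def lessThan_atLeast0)
  ultimately have "(\<Sum>p | p permutes {0..<n}. D p) = (\<Sum>i<n. B (i, i))"
    by (subst sum.remove[of _ id]) (auto simp: permutes_id finite_permutations intro!: sum.neutral)
  with der show ?thesis
    by (simp add: mdet_leibniz \<delta>_def)
qed

section \<open>Bases of extremal determinant\<close>

text \<open>
  The action of an \<open>n \<times> n\<close> matrix on \<open>n\<close>-tuples of vectors: row \<open>i\<close> of \<open>P\<close> gives the \<open>i\<close>-th
  entry of the tuple \<open>P v\<close>.
\<close>

definition mix :: "nat \<Rightarrow> (nat \<times> nat \<Rightarrow> real) \<Rightarrow> (nat \<Rightarrow> 'a::real_vector) \<Rightarrow> nat \<Rightarrow> 'a" where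
  "mix n P v i = (\<Sum>j<n. P (i, j) *\<^sub>R v j)"

lemma mix_mix: "mix n P (mix n C v) = mix n (\<lambda>(i, j). \<Sum>k<n. P (i, k) * C (k, j)) v"
proof (rule ext)
  fix i
  have "mix n P (mix n C v) i = (\<Sum>k<n. \<Sum>j<n. (P (i, k) * C (k, j)) *\<^sub>R v j)"
    by (simp add: mix_def scaleR_sum_right)
  also have "\<dots> = (\<Sum>j<n. \<Sum>k<n. (P (i, k) * C (k, j)) *\<^sub>R v j)"
    by (rule sum.swap)
  finally show "mix n P (mix n C v) i = mix n (\<lambda>(i, j). \<Sum>k<n. P (i, k) * C (k, j)) v i"
    by (simp add: mix_def scaleR_sum_left)
qed

text \<open>
  A substitute for ``norm on \<open>n\<close>-tuples'': the triangle inequality is used only through its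
  consequence that \<open>\<alpha>\<close> is Lipschitz, which also says that \<open>\<alpha>\<close> depends on the first \<open>n\<close> entries
  only.
\<close>

definition tuple_norm :: "nat \<Rightarrow> ((nat \<Rightarrow> 'a::real_normed_vector) \<Rightarrow> real) \<Rightarrow> bool" where
  "tuple_norm n \<alpha> \<longleftrightarrow>
     (\<forall>v w. \<bar>\<alpha> v - \<alpha> w\<bar> \<le> (\<Sum>i<n. norm (v i - w i))) \<and>
     (\<forall>c v. \<alpha> (\<lambda>i. c *\<^sub>R v i) = \<bar>c\<bar> * \<alpha> v) \<and>
     (\<forall>v. (\<exists>i<n. v i \<noteq> 0) \<longrightarrow> \<alpha> v > 0)"

lemma continuous_on_tuple_norm_mix:
  assumes "tuple_norm n \<alpha>"
  shows "continuous_on S (\<lambda>C. \<alpha> (mix n C u))"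
  unfolding continuous_on_def
proof
  fix C0 assume "C0 \<in> S"
  define h where "h C = (\<Sum>i<n. norm (mix n C u i - mix n C0 u i))" for C
  have "continuous_on UNIV h"
    unfolding h_def mix_def by (intro continuous_intros continuous_on_product_coordinates)
  then have "(h \<longlongrightarrow> h C0) (at C0 within S)"
    by (metis UNIV_I continuous_on_def subset_UNIV tendsto_within_subset)
  then have h: "(h \<longlongrightarrow> 0) (at C0 within S)"
    by (simp add: h_def)
  have "\<bar>\<alpha> (mix n C u) - \<alpha> (mix n C0 u)\<bar> \<le> h C" for C
    using assms unfolding tuple_norm_def h_def by blast
  then have "((\<lambda>C. \<alpha> (mix n C u) - \<alpha> (mix n C0 u)) \<longlongrightarrow> 0) (at C0 within S)"
    by (intro Lim_null_comparison[OF _ h]) simp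
  then show "((\<lambda>C. \<alpha> (mix n C u)) \<longlongrightarrow> \<alpha> (mix n C0 u)) (at C0 within S)"
    by (rule LIM_zero_cancel)
qed

lemma tuple_norm_cong:
  assumes "tuple_norm n \<alpha>" "\<And>i. i < n \<Longrightarrow> v i = w i"
  shows "\<alpha> v = \<alpha> w"
proof -
  have "\<bar>\<alpha> v - \<alpha> w\<bar> \<le> (\<Sum>i<n. norm (v i - w i))"
    using assms(1) unfolding tuple_norm_def by blast
  also have "\<dots> = 0"
    using assms(2) by simp
  finally show ?thesis
    by simp
qed

lemma compact_matrix_sphere:
  "compact {C :: nat \<times> nat \<Rightarrow> real. (\<forall>x. C x \<in> (if fst x < n \<and> snd x < n then {-1..1} else {0})) \<and>
     (\<Sum>i<n. \<Sum>j<n. \<bar>C (i, j)\<bar>) = 1}" (is "compact {C. ?box C \<and> ?sphere C}")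
proof -
  let ?I = "\<lambda>x :: nat \<times> nat. if fst x < n \<and> snd x < n then {-1..1} else {0::real}"
  have "compactin (product_topology (\<lambda>_. euclidean) UNIV) (PiE UNIV ?I)"
    unfolding compactin_PiE by (simp add: compactin_euclidean_iff)
  then have "compact (PiE UNIV ?I)"
    by (simp add: euclidean_product_topology compactin_euclidean_iff)
  then have "compact {C. ?box C}"
    by (simp add: PiE_UNIV_domain Pi_def)
  moreover have "closed {C :: nat \<times> nat \<Rightarrow> real. ?sphere C}"
    by (intro closed_Collect_eq continuous_intros continuous_on_product_coordinates)
  ultimately show ?thesis
    by (simp add: Collect_conj_eq compact_Int_closed)
qed

lemma finite_dim_basis_enum:
  fixes V :: "'a::real_vector set"
  assumes dim: "dim V = n" and n: "n \<ge> 1"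
  shows "\<exists>u. (\<forall>c. (\<Sum>i<n. c i *\<^sub>R u i) = 0 \<longrightarrow> (\<forall>i<n. c i = 0)) \<and>
    (\<forall>x\<in>V. \<exists>c. x = (\<Sum>i<n. c i *\<^sub>R u i))"
proof -
  obtain B where B: "B \<subseteq> V" "independent B" "V \<subseteq> span B" "card B = n"
    using real_vector.basis_exists[of V] dim by metis
  have fin: "finite B"
    using B(4) n by (simp add: card_ge_0_finite)
  obtain u where u: "bij_betw u {..<n} B"
    using ex_bij_betw_nat_finite[OF fin] B(4) by (auto simp: lessThan_atLeast0)
  define u' where "u' = the_inv_into {..<n} u"
  have u': "u' (u i) = i" if "i < n" for i
    using that u by (simp add: u'_def bij_betw_def the_inv_into_f_f)
  have reindex: "(\<Sum>b\<in>B. c b *\<^sub>R b) = (\<Sum>i<n. c (u i) *\<^sub>R u i)" for c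
    using sum.reindex_bij_betw[OF u, of "\<lambda>b. c b *\<^sub>R b"] by simp
  show ?thesis
  proof (intro exI[of _ u] conjI allI impI ballI)
    show "c i = 0" if c: "(\<Sum>i<n. c i *\<^sub>R u i) = 0" and i: "i < n" for c i
    proof -
      have "(\<Sum>b\<in>B. c (u' b) *\<^sub>R b) = 0"
        using c by (simp add: reindex u')
      then have "c (u' b) = 0" if "b \<in> B" for b
        using B(2) fin that real_vector.dependent_finite[OF fin] by metis
      then show ?thesis
        using u u' i by (metis bij_betwE lessThan_iff)
    qed
    show "\<exists>c. x = (\<Sum>i<n. c i *\<^sub>R u i)" if x: "x \<in> V" for x
    proof -
      have "x \<in> range (\<lambda>c. \<Sum>b\<in>B. c b *\<^sub>R b)"
        using x B(3) real_vector.span_finite[OF fin] by blast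
      then show ?thesis
        by (auto simp: reindex intro: exI[of _ "\<lambda>i. _ (u i)"])
    qed
  qed
qed

text \<open>
  Let \<open>u\<close> be a basis of the span of \<open>V\<close>. The quotient \<open>det C / \<alpha>(C u)\<^sup>n\<close> is invariant under positive scaling
  of \<open>C\<close>, so it attains its maximum over all nonzero matrices on a compact sphere. The tuple
  \<open>v = C u\<close> for a maximizing \<open>C\<close> has the stated property, because \<open>P v = (P C) u\<close> and
  \<open>det (P C) = det P \<sqdot> det C\<close>. The maximum is positive since the identity matrix competes; hence
  \<open>C\<close> is invertible and \<open>v\<close> still spans \<open>V\<close>.
\<close>

lemma extremal_basis:
  fixes V :: "'a::real_normed_vector set"
  assumes dim: "dim V = n" and n: "n \<ge> 1" and \<alpha>: "tuple_norm n \<alpha>"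
  shows "\<exists>v. \<alpha> v > 0 \<and> (\<forall>x\<in>V. \<exists>a. x = (\<Sum>i<n. a i *\<^sub>R v i)) \<and>
    (\<forall>P. mdet n P * \<alpha> v ^ n \<le> \<alpha> (mix n P v) ^ n)"
proof -
  obtain u where indep: "\<And>c. (\<Sum>i<n. c i *\<^sub>R u i) = 0 \<Longrightarrow> \<forall>i<n. c i = 0"
    and span: "\<And>x. x \<in> V \<Longrightarrow> \<exists>c. x = (\<Sum>i<n. c i *\<^sub>R u i)"
    using finite_dim_basis_enum[OF dim n] by blast
  \<comment> \<open>The size of a matrix that defines the sphere.\<close>
  define tot :: "(nat \<times> nat \<Rightarrow> real) \<Rightarrow> real" where "tot C = (\<Sum>i<n. \<Sum>j<n. \<bar>C (i, j)\<bar>)" for C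
  define S where "S = {C. (\<forall>x. C x \<in> (if fst x < n \<and> snd x < n then {-1..1} else {0})) \<and> tot C = 1}"
  define Q where "Q C = mdet n C / \<alpha> (mix n C u) ^ n" for C
  have hom: "\<alpha> (\<lambda>i. c *\<^sub>R v i) = \<bar>c\<bar> * \<alpha> v" for c v
    using \<alpha> by (simp add: tuple_norm_def)
  have nonneg: "\<alpha> v \<ge> 0" for v
  proof -
    have "0 = \<alpha> (\<lambda>i. 0)"
      using hom[of 0 v] by simp
    then show ?thesis
    proof (cases "\<exists>i<n. v i \<noteq> 0")
      case True
      then show ?thesis
        using \<alpha> by (auto simp: tuple_norm_def intro: less_imp_le)
    next
      case False
      then show ?thesis
        using tuple_norm_cong[OF \<alpha>, of v "\<lambda>i. 0"] \<open>0 = \<alpha> (\<lambda>i. 0)\<close> by auto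
    qed
  qed
  have tot0: "tot C = 0 \<longleftrightarrow> (\<forall>i<n. \<forall>j<n. C (i, j) = 0)" for C
    unfolding tot_def by (auto simp: sum_nonneg_eq_0_iff sum_nonneg)
  have pos: "\<alpha> (mix n C u) > 0" if "tot C \<noteq> 0" for C
  proof -
    have "\<exists>i<n. \<exists>j<n. C (i, j) \<noteq> 0"
      using that tot0[of C] by auto
    then obtain i j where ij: "i < n" "j < n" "C (i, j) \<noteq> 0"
      by blast
    then have "mix n C u i \<noteq> 0"
      using indep[of "\<lambda>j. C (i, j)"] unfolding mix_def by blast
    then show ?thesis
      using ij(1) \<alpha> unfolding tuple_norm_def by blast
  qed
  have det_tot: "tot C \<noteq> 0" if "mdet n C \<noteq> 0" for C
    using that mdet_zero[OF n] tot0 by blast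
  \<comment> \<open>Radial projection onto the sphere; entries outside the \<open>n \<times> n\<close> block are set to zero.\<close>
  define nrm where "nrm C = (\<lambda>x. if fst x < n \<and> snd x < n then C x / tot C else 0)" for C
  have nrm: "nrm C \<in> S" "Q (nrm C) = Q C" if C: "tot C \<noteq> 0" for C
  proof -
    have "tot C \<ge> 0"
      unfolding tot_def by (intro sum_nonneg) auto
    with C have tp: "tot C > 0"
      by linarith
    have le: "\<bar>C (i, j)\<bar> \<le> tot C" if "i < n" "j < n" for i j
    proof -
      have "\<bar>C (i, j)\<bar> \<le> (\<Sum>j<n. \<bar>C (i, j)\<bar>)"
        using that by (intro member_le_sum) auto
      also have "\<dots> \<le> tot C"
        unfolding tot_def using that by (intro member_le_sum[of i]) (auto intro: sum_nonneg)
      finally show ?thesis .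
    qed
    have entry: "nrm C (i, j) = C (i, j) / tot C" if "i < n" "j < n" for i j
      using that by (simp add: nrm_def)
    have "tot (nrm C) = (\<Sum>i<n. \<Sum>j<n. \<bar>nrm C (i, j)\<bar>)"
      by (rule tot_def)
    also have "\<dots> = (\<Sum>i<n. \<Sum>j<n. \<bar>C (i, j)\<bar> / tot C)"
      using tp by (intro sum.cong) (auto simp: entry)
    also have "\<dots> = 1"
      using tp by (simp add: tot_def flip: sum_divide_distrib)
    finally have "tot (nrm C) = 1" .
    moreover have "- 1 \<le> C (i, j) / tot C" "C (i, j) / tot C \<le> 1" if "i < n" "j < n" for i j
      using le[OF that] tp by (auto simp: divide_le_eq le_divide_eq abs_le_iff)
    ultimately show "nrm C \<in> S"
      by (auto simp: S_def nrm_def)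
    have "mdet n (nrm C) = mdet n (\<lambda>x. (1 / tot C) * C x)"
      unfolding mdet_leibniz nrm_def
      by (intro sum.cong prod.cong arg_cong2[where f = "(*)"] refl)
        (auto dest: permutes_in_image)
    also have "\<dots> = (1 / tot C) ^ n * mdet n C"
      by (rule mdet_scale)
    finally have d: "mdet n (nrm C) = (1 / tot C) ^ n * mdet n C" .
    have "\<alpha> (mix n (nrm C) u) = \<alpha> (\<lambda>i. (1 / tot C) *\<^sub>R mix n C u i)"
      by (rule tuple_norm_cong[OF \<alpha>])
        (auto simp: mix_def nrm_def scaleR_sum_right divide_inverse mult.commute intro!: sum.cong)
    also have "\<dots> = (1 / tot C) * \<alpha> (mix n C u)"
      using tp by (simp add: hom)
    finally show "Q (nrm C) = Q C"
      using tp d by (simp add: Q_def power_mult_distrib power_divide)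
  qed
  define I :: "nat \<times> nat \<Rightarrow> real" where "I = (\<lambda>(i, j). if i = j then 1 else 0)"
  have detI: "mdet n I = 1"
    unfolding I_def by (rule mdet_identity)
  have "compact S"
    unfolding S_def tot_def by (rule compact_matrix_sphere)
  moreover have "S \<noteq> {}"
    using nrm(1)[OF det_tot, of I] detI by auto
  moreover have "\<alpha> (mix n C u) ^ n \<noteq> 0" if "C \<in> S" for C
    using pos[of C] that by (simp add: S_def)
  then have "continuous_on S Q"
    unfolding Q_def
    by (intro continuous_intros continuous_on_mdet continuous_on_tuple_norm_mix \<alpha>) auto
  ultimately obtain C where C: "C \<in> S" and max: "\<And>C'. C' \<in> S \<Longrightarrow> Q C' \<le> Q C"
    using continuous_attains_sup[of S Q] by blast
  have max': "Q C' \<le> Q C" if "tot C' \<noteq> 0" for C'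
    using max[OF nrm(1)[OF that]] nrm(2)[OF that] by simp
  define v where "v = mix n C u"
  have vpos: "\<alpha> v > 0"
    unfolding v_def using C by (intro pos) (simp add: S_def)
  have "Q I > 0"
    using detI det_tot[of I] pos[of I] by (simp add: Q_def)
  then have "Q C > 0"
    using max'[of I] det_tot[of I] detI by auto
  then have detC: "mdet n C > 0"
    using vpos by (simp add: Q_def v_def zero_less_divide_iff)
  show ?thesis
  proof (intro exI[of _ v] conjI allI ballI)
    show "\<alpha> v > 0" by fact
    show "\<exists>a. x = (\<Sum>i<n. a i *\<^sub>R v i)" if x: "x \<in> V" for x
    proof -
      obtain W where W: "\<And>i j. i < n \<Longrightarrow> j < n \<Longrightarrow>
          (\<Sum>k<n. W (i, k) * C (k, j)) = (if i = j then 1 else 0)"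
        using mdet_left_inverse[of n C] detC by auto
      have u: "u i = (\<Sum>k<n. W (i, k) *\<^sub>R v k)" if "i < n" for i
      proof -
        have "(\<Sum>k<n. W (i, k) *\<^sub>R v k) = mix n W (mix n C u) i"
          by (simp add: mix_def v_def)
        also have "\<dots> = (\<Sum>j<n. (if i = j then 1 else 0) *\<^sub>R u j)"
          unfolding mix_mix by (simp add: mix_def W that)
        also have "\<dots> = u i"
          using that by (simp add: if_distrib[of "\<lambda>c. c *\<^sub>R _"] sum.delta cong: if_cong)
        finally show ?thesis by simp
      qed
      obtain c where "x = (\<Sum>i<n. c i *\<^sub>R u i)"
        using span[OF x] by blast
      also have "\<dots> = (\<Sum>i<n. c i *\<^sub>R (\<Sum>k<n. W (i, k) *\<^sub>R v k))"
        using u by (intro sum.cong) auto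
      also have "\<dots> = (\<Sum>i<n. \<Sum>k<n. (c i * W (i, k)) *\<^sub>R v k)"
        by (simp add: scaleR_sum_right)
      also have "\<dots> = (\<Sum>k<n. \<Sum>i<n. (c i * W (i, k)) *\<^sub>R v k)"
        by (rule sum.swap)
      also have "\<dots> = (\<Sum>k<n. (\<Sum>i<n. c i * W (i, k)) *\<^sub>R v k)"
        by (simp add: scaleR_sum_left)
      finally show ?thesis
        by (intro exI[of _ "\<lambda>k. \<Sum>i<n. c i * W (i, k)"])
    qed
    show "mdet n P * \<alpha> v ^ n \<le> \<alpha> (mix n P v) ^ n" for P
    proof (cases "mdet n P \<le> 0")
      case True
      then have "mdet n P * \<alpha> v ^ n \<le> 0"
        using vpos by (intro mult_nonpos_nonneg) auto
      then show ?thesis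
        using nonneg[of "mix n P v"] by (meson order_trans zero_le_power)
    next
      case False
      define PC where "PC = (\<lambda>(i, j). \<Sum>k<n. P (i, k) * C (k, j))"
      have d: "mdet n PC = mdet n P * mdet n C"
        unfolding PC_def by (rule mdet_mult)
      then have "tot PC \<noteq> 0"
        using False detC by (intro det_tot) auto
      moreover have e: "mix n PC u = mix n P v"
        by (simp add: PC_def v_def mix_mix)
      ultimately have "mdet n P * mdet n C / \<alpha> (mix n P v) ^ n \<le> mdet n C / \<alpha> v ^ n"
        and "\<alpha> (mix n P v) > 0"
        using max'[of PC] pos[of PC] by (simp_all add: Q_def d v_def)
      then show ?thesis
        using detC vpos by (simp add: field_simps)
    qed
  qed
qed

section \<open>Euclidean frames and John's theorem\<close>

text \<open>
  For a subspace \<open>V\<close> of dimension \<open>n\<close>, the tuple \<open>v\<close> witnesses that the Banach--Mazur distance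
  from \<open>V\<close> to Euclidean space is at most \<open>D\<close>, in the form in which it is used: contractivity of \<open>a \<mapsto> \<Sum>\<^sub>i a\<^sub>i v\<^sub>i\<close> and short preimages.
\<close>

definition euclidean_frame :: "nat \<Rightarrow> real \<Rightarrow> 'a::real_normed_vector set \<Rightarrow> (nat \<Rightarrow> 'a) \<Rightarrow> bool" where
  "euclidean_frame n D V v \<longleftrightarrow>
     (\<forall>a. norm (\<Sum>i<n. a i *\<^sub>R v i) \<le> L2_set a {..<n}) \<and>
     (\<forall>x\<in>V. \<exists>a. (\<Sum>i<n. a i *\<^sub>R v i) = x \<and> L2_set a {..<n} \<le> D * norm x)"

lemma L2_set_power2: "(L2_set f A)\<^sup>2 = (\<Sum>i\<in>A. (f i)\<^sup>2)"
  by (simp add: L2_set_def sum_nonneg)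

lemma L2_set_scale: "L2_set (\<lambda>i. c * f i) A = \<bar>c\<bar> * L2_set f A"
  by (simp add: L2_set_def power_mult_distrib real_sqrt_mult flip: sum_distrib_left)

lemma L2_set_lincomb_power2:
  "(L2_set (\<lambda>i. x * f i + y * g i) A)\<^sup>2 =
     x\<^sup>2 * (L2_set f A)\<^sup>2 + 2 * x * y * (\<Sum>i\<in>A. f i * g i) + y\<^sup>2 * (L2_set g A)\<^sup>2"
  unfolding L2_set_power2
  by (simp add: power2_sum power_mult_distrib sum.distrib sum_distrib_left algebra_simps)

lemma abs_le_L2_set: "finite A \<Longrightarrow> i \<in> A \<Longrightarrow> \<bar>f i\<bar> \<le> L2_set f A"
  using member_le_L2_set[of A i "\<lambda>i. \<bar>f i\<bar>"] by (simp add: L2_set_def)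

lemma le_one_plus_half_if_power2_le:
  fixes L y :: real
  assumes "L\<^sup>2 \<le> 1 + 2 * y"
  shows "L \<le> 1 + y"
proof (rule power2_le_imp_le)
  have "(1 + y)\<^sup>2 = 1 + 2 * y + y\<^sup>2"
    by (simp add: power2_sum)
  then show "L\<^sup>2 \<le> (1 + y)\<^sup>2"
    using assms zero_le_power2[of y] by linarith
  have "0 \<le> 1 + 2 * y"
    using assms by (meson order_trans zero_le_power2)
  then show "0 \<le> 1 + y"
    by simp
qed

text \<open>
  The operator norm of the map \<open>a \<mapsto> \<Sum>\<^sub>i a\<^sub>i v\<^sub>i\<close> on Euclidean \<open>\<real>\<^sup>n\<close>.
\<close>

definition op_norm_L2 :: "nat \<Rightarrow> (nat \<Rightarrow> 'a::real_normed_vector) \<Rightarrow> real" where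
  "op_norm_L2 n v = (SUP a\<in>{a. L2_set a {..<n} \<le> 1}. norm (\<Sum>i<n. a i *\<^sub>R v i))"

lemma norm_synthesis_le_sum:
  fixes v :: "nat \<Rightarrow> 'a::real_normed_vector"
  assumes "L2_set a {..<n} \<le> 1"
  shows "norm (\<Sum>i<n. a i *\<^sub>R v i) \<le> (\<Sum>i<n. norm (v i))"
proof (rule order_trans[OF norm_sum sum_mono])
  fix i assume "i \<in> {..<n}"
  then have "\<bar>a i\<bar> \<le> 1"
    using abs_le_L2_set[of "{..<n}" i a] assms by simp
  then show "norm (a i *\<^sub>R v i) \<le> norm (v i)"
    by (simp add: mult_left_le_one_le)
qed

lemma norm_synthesis_le_op_norm:
  assumes "L2_set a {..<n} \<le> 1"
  shows "norm (\<Sum>i<n. a i *\<^sub>R v i) \<le> op_norm_L2 n v"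
  unfolding op_norm_L2_def
  using assms norm_synthesis_le_sum[of _ n v] by (intro cSUP_upper bdd_aboveI2) auto

lemma op_norm_L2_least:
  assumes "\<And>a. L2_set a {..<n} \<le> 1 \<Longrightarrow> norm (\<Sum>i<n. a i *\<^sub>R v i) \<le> c"
  shows "op_norm_L2 n v \<le> c"
  unfolding op_norm_L2_def
proof (rule cSUP_least)
  have "(\<lambda>i. 0) \<in> {a. L2_set a {..<n} \<le> 1}"
    by (simp add: L2_set_def)
  then show "{a. L2_set a {..<n} \<le> 1} \<noteq> {}"
    by blast
qed (use assms in auto)

lemma norm_synthesis_le:
  "norm (\<Sum>i<n. a i *\<^sub>R v i) \<le> op_norm_L2 n v * L2_set a {..<n}"
proof (cases "L2_set a {..<n} = 0")
  case True
  then have "\<forall>i<n. a i = 0"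
    by (simp add: L2_set_eq_0_iff)
  with True show ?thesis
    by simp
next
  case False
  define r where "r = L2_set a {..<n}"
  have r: "r > 0"
    using False by (simp add: r_def order_less_le)
  have "norm (\<Sum>i<n. ((1 / r) * a i) *\<^sub>R v i) \<le> op_norm_L2 n v"
    by (rule norm_synthesis_le_op_norm) (use r in \<open>simp only: L2_set_scale, simp add: r_def\<close>)
  also have "(\<Sum>i<n. ((1 / r) * a i) *\<^sub>R v i) = (1 / r) *\<^sub>R (\<Sum>i<n. a i *\<^sub>R v i)"
    by (simp add: scaleR_sum_right)
  finally show ?thesis
    using r by (simp add: r_def divide_le_eq)
qed

lemma tuple_norm_op_norm_L2: "tuple_norm n (op_norm_L2 n)"
  unfolding tuple_norm_def
proof (intro conjI allI impI)
  have le: "op_norm_L2 n v \<le> op_norm_L2 n w + (\<Sum>i<n. norm (v i - w i))" for v w :: "nat \<Rightarrow> 'a"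
  proof (rule op_norm_L2_least)
    fix a assume a: "L2_set a {..<n} \<le> 1"
    have "norm (\<Sum>i<n. a i *\<^sub>R v i) =
        norm ((\<Sum>i<n. a i *\<^sub>R w i) + (\<Sum>i<n. a i *\<^sub>R (v i - w i)))"
      by (simp add: scaleR_diff_right sum_subtractf)
    also have "\<dots> \<le> op_norm_L2 n w + (\<Sum>i<n. norm (v i - w i))"
      by (intro norm_triangle_mono norm_synthesis_le_op_norm norm_synthesis_le_sum a)
    finally show "norm (\<Sum>i<n. a i *\<^sub>R v i) \<le> \<dots>" .
  qed
  show "\<bar>op_norm_L2 n v - op_norm_L2 n w\<bar> \<le> (\<Sum>i<n. norm (v i - w i))" for v w :: "nat \<Rightarrow> 'a"
    using le[of v w] le[of w v] by (simp add: norm_minus_commute)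
  have zero: "op_norm_L2 n (\<lambda>i. 0 :: 'a) = 0"
    using op_norm_L2_least[of n "\<lambda>i. 0 :: 'a" 0] norm_synthesis_le_op_norm[of "\<lambda>i. 0" n "\<lambda>i. 0 :: 'a"]
    by (simp add: L2_set_def)
  have scale_le: "op_norm_L2 n (\<lambda>i. c *\<^sub>R v i) \<le> \<bar>c\<bar> * op_norm_L2 n v" for c and v :: "nat \<Rightarrow> 'a"
  proof (rule op_norm_L2_least)
    fix a assume a: "L2_set a {..<n} \<le> 1"
    have "(\<Sum>i<n. a i *\<^sub>R c *\<^sub>R v i) = c *\<^sub>R (\<Sum>i<n. a i *\<^sub>R v i)"
      by (simp add: scaleR_sum_right mult.commute)
    then show "norm (\<Sum>i<n. a i *\<^sub>R c *\<^sub>R v i) \<le> \<bar>c\<bar> * op_norm_L2 n v"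
      by (simp add: mult_left_mono norm_synthesis_le_op_norm[OF a])
  qed
  show "op_norm_L2 n (\<lambda>i. c *\<^sub>R v i) = \<bar>c\<bar> * op_norm_L2 n v" for c and v :: "nat \<Rightarrow> 'a"
  proof (cases "c = 0")
    case True
    then show ?thesis by (simp add: zero)
  next
    case False
    have "op_norm_L2 n v \<le> \<bar>1 / c\<bar> * op_norm_L2 n (\<lambda>i. c *\<^sub>R v i)"
      using scale_le[of "1 / c" "\<lambda>i. c *\<^sub>R v i"] False by simp
    then show ?thesis
      using scale_le[of c v] False by (simp add: field_simps)
  qed
  show "0 < op_norm_L2 n v" if nz: "\<exists>i<n. v i \<noteq> 0" for v :: "nat \<Rightarrow> 'a"
  proof -
    obtain i where i: "i < n" "v i \<noteq> 0"
      using nz by blast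
    define e :: "nat \<Rightarrow> real" where "e j = (if j = i then 1 else 0)" for j
    have "L2_set e {..<n} = 1"
      using i(1) by (simp add: L2_set_def e_def if_distrib[of "\<lambda>x. x\<^sup>2"] cong: if_cong)
    then have "norm (\<Sum>j<n. e j *\<^sub>R v j) \<le> op_norm_L2 n v"
      by (intro norm_synthesis_le_op_norm) simp
    moreover have "(\<Sum>j<n. e j *\<^sub>R v j) = v i"
      using i(1) by (simp add: e_def if_distrib[of "\<lambda>c. c *\<^sub>R _"] cong: if_cong)
    ultimately have "norm (v i) \<le> op_norm_L2 n v"
      by simp
    then show ?thesis
      using i(2) by (meson less_le_trans zero_less_norm_iff)
  qed
qed

text \<open>
  The operator in question is \<open>T\<close> composed with \<open>I + s B\<close> for \<open>B = w w\<^sup>T - I\<close>. Its norm exceeds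
  \<open>1\<close> only to second order in \<open>s\<close>: let \<open>t\<close> be the inner product of \<open>a\<close> and \<open>w\<close>. For \<open>|t| \<le> 1\<close> the
  vector \<open>(1 - s) a + s t w\<close> itself has length at most \<open>1 + O(s\<^sup>2)\<close>. For \<open>|t| > 1\<close> it is too long,
  but it is the sum of a vector of length \<open>1 - s - s|t| + O(s\<^sup>2)\<close> and a multiple \<open>\<plusminus> s(1 + |t|) w\<close>
  of \<open>w\<close>, whose image has norm at most \<open>s(1 + |t|)\<close> because \<open>\<parallel>T w\<parallel> \<le> 1\<close>. In the language of
  John's ellipsoid, the deformed ellipsoid stays in the convex hull of the ball and \<open>\<plusminus>w\<close> up to
  second order.
\<close>

lemma op_norm_L2_second_order:
  fixes v :: "nat \<Rightarrow> 'a::real_normed_vector"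
  assumes s: "0 \<le> s" "s \<le> 1"
    and T: "\<And>a. norm (\<Sum>i<n. a i *\<^sub>R v i) \<le> L2_set a {..<n}"
    and w: "norm (\<Sum>i<n. w i *\<^sub>R v i) \<le> 1"
    and a: "L2_set a {..<n} \<le> 1"
  defines "r \<equiv> L2_set w {..<n}" and "t \<equiv> (\<Sum>i<n. a i * w i)"
  shows "norm (\<Sum>i<n. ((1 - s) * a i + s * t * w i) *\<^sub>R v i) \<le> 1 + (1 + r\<^sup>2) * s\<^sup>2"
proof -
  have a2: "(L2_set a {..<n})\<^sup>2 \<le> 1"
    using a by (simp add: power_le_one)
  have sq: "(L2_set (\<lambda>i. (1 - s) * a i + y * w i) {..<n})\<^sup>2 \<le>
      (1 - s)\<^sup>2 + 2 * (1 - s) * y * t + y\<^sup>2 * r\<^sup>2" for y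
  proof -
    have "(1 - s)\<^sup>2 * (L2_set a {..<n})\<^sup>2 \<le> (1 - s)\<^sup>2"
      using a2 by (intro mult_left_le) auto
    then show ?thesis
      unfolding L2_set_lincomb_power2 t_def r_def by (simp add: mult_ac)
  qed
  have abs_t: "2 * \<bar>t\<bar> \<le> 1 + r\<^sup>2"
  proof -
    have "0 \<le> (L2_set (\<lambda>i. 1 * a i + y * w i) {..<n})\<^sup>2" for y
      by simp
    from this[of 1] this[of "-1"] show ?thesis
      using a2 unfolding L2_set_lincomb_power2 t_def r_def by simp
  qed
  show ?thesis
  proof (cases "\<bar>t\<bar> \<le> 1")
    case True
    then have t2: "t\<^sup>2 \<le> 1"
      using abs_le_square_iff[of t 1] by simp
    have "(1 - s)\<^sup>2 + 2 * (1 - s) * (s * t) * t + (s * t)\<^sup>2 * r\<^sup>2 \<le>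
        (1 - s)\<^sup>2 + 2 * (1 - s) * s * 1 + s\<^sup>2 * 1 * r\<^sup>2"
    proof -
      have "2 * (1 - s) * s * t\<^sup>2 \<le> 2 * (1 - s) * s * 1" "s\<^sup>2 * t\<^sup>2 * r\<^sup>2 \<le> s\<^sup>2 * 1 * r\<^sup>2"
        using t2 s by (intro mult_left_mono mult_right_mono; simp)+
      then show ?thesis
        by (simp add: power2_eq_square algebra_simps)
    qed
    also have "\<dots> \<le> 1 + 2 * ((1 + r\<^sup>2) * s\<^sup>2)"
    proof -
      have "0 \<le> r\<^sup>2 * s\<^sup>2" "0 \<le> s\<^sup>2"
        by simp_all
      then show ?thesis
        by (simp add: power2_eq_square algebra_simps)
    qed
    finally have "L2_set (\<lambda>i. (1 - s) * a i + s * t * w i) {..<n} \<le> 1 + (1 + r\<^sup>2) * s\<^sup>2"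
      by (rule le_one_plus_half_if_power2_le[OF order_trans[OF sq]])
    then show ?thesis
      using T by (rule order_trans[rotated])
  next
    case False
    define \<sigma> where "\<sigma> = sgn t"
    have \<sigma>: "\<sigma> * t = \<bar>t\<bar>" "\<sigma>\<^sup>2 = 1" "\<bar>\<sigma>\<bar> = 1" "\<sigma> * \<bar>t\<bar> = t"
      using False by (auto simp: \<sigma>_def sgn_if abs_if)
    have split: "(\<Sum>i<n. ((1 - s) * a i + s * t * w i) *\<^sub>R v i) =
        (\<Sum>i<n. ((1 - s) * a i + (- s * \<sigma>) * w i) *\<^sub>R v i) +
        (s * \<sigma> * (\<bar>t\<bar> + 1)) *\<^sub>R (\<Sum>i<n. w i *\<^sub>R v i)"
    proof -
      have "s * \<sigma> * (\<bar>t\<bar> + 1) = s * t + s * \<sigma>"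
        using \<sigma>(4) by (simp add: algebra_simps)
      then show ?thesis
        by (simp only: scaleR_sum_right) (simp add: algebra_simps flip: sum.distrib)
    qed
    have "(1 - s)\<^sup>2 + 2 * (1 - s) * (- s * \<sigma>) * t + (- s * \<sigma>)\<^sup>2 * r\<^sup>2 =
        (1 - s)\<^sup>2 - 2 * (1 - s) * s * (\<sigma> * t) + s\<^sup>2 * \<sigma>\<^sup>2 * r\<^sup>2"
      by (simp add: power_mult_distrib mult_ac)
    also have "\<dots> = 1 + 2 * (- s - s * \<bar>t\<bar>) + s\<^sup>2 * (1 + 2 * \<bar>t\<bar> + r\<^sup>2)"
      unfolding \<sigma> by (simp add: power2_eq_square algebra_simps)
    also have "\<dots> \<le> 1 + 2 * (- s - s * \<bar>t\<bar>) + s\<^sup>2 * (2 * (1 + r\<^sup>2))"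
      using abs_t by (intro add_left_mono mult_left_mono) auto
    also have "\<dots> = 1 + 2 * (- s - s * \<bar>t\<bar> + s\<^sup>2 * (1 + r\<^sup>2))"
      by simp
    finally have "L2_set (\<lambda>i. (1 - s) * a i + (- s * \<sigma>) * w i) {..<n} \<le>
        1 + (- s - s * \<bar>t\<bar> + s\<^sup>2 * (1 + r\<^sup>2))"
      by (rule le_one_plus_half_if_power2_le[OF order_trans[OF sq]])
    moreover have "norm ((s * \<sigma> * (\<bar>t\<bar> + 1)) *\<^sub>R (\<Sum>i<n. w i *\<^sub>R v i)) \<le> s * (\<bar>t\<bar> + 1)"
      using s \<sigma>(3) w by (simp add: abs_mult mult_left_le)
    ultimately show ?thesis
      unfolding split
      by (intro norm_triangle_le order_trans[OF add_mono[OF T]]) (auto simp: algebra_simps)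
  qed
qed

lemma mix_identity_perturbation:
  fixes v :: "nat \<Rightarrow> 'a::real_vector"
  assumes "i < n"
  shows "mix n (\<lambda>(i, j). (if i = j then 1 else 0) + s * B (i, j)) v i =
    v i + s *\<^sub>R (\<Sum>j<n. B (i, j) *\<^sub>R v j)"
  using assms
  by (simp add: mix_def scaleR_add_left sum.distrib scaleR_sum_right
      if_distrib[of "\<lambda>c. c *\<^sub>R _"] cong: if_cong)

text \<open>
  Normalize an extremal basis for the operator norm so that this norm is \<open>1\<close>. If some \<open>w\<close> had
  \<open>\<parallel>T w\<parallel> \<le> 1\<close> and \<open>|w|\<^sup>2 > n\<close>, then for \<open>B = w w\<^sup>T - I\<close> the determinant of \<open>I + s B\<close> would grow
  at the positive rate \<open>trace B = |w|\<^sup>2 - n\<close>, whereas the operator norm of the perturbed tuple grows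
  only to second order; this contradicts extremality.
\<close>

theorem john_euclidean_frame:
  fixes V :: "'a::real_normed_vector set"
  assumes dim: "dim V = n" and n: "n \<ge> 1"
  shows "\<exists>v. euclidean_frame n (sqrt n) V v"
proof -
  obtain v0 where pos: "op_norm_L2 n v0 > 0"
    and span0: "\<And>x. x \<in> V \<Longrightarrow> \<exists>a. x = (\<Sum>i<n. a i *\<^sub>R v0 i)"
    and ext0: "\<And>P. mdet n P * op_norm_L2 n v0 ^ n \<le> op_norm_L2 n (mix n P v0) ^ n"
    using extremal_basis[OF dim n tuple_norm_op_norm_L2] by blast
  define c where "c = op_norm_L2 n v0"
  define v where "v i = (1 / c) *\<^sub>R v0 i" for i
  have hom: "op_norm_L2 n (\<lambda>i. b *\<^sub>R u i) = \<bar>b\<bar> * op_norm_L2 n u" for b and u :: "nat \<Rightarrow> 'a"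
    using tuple_norm_op_norm_L2 unfolding tuple_norm_def by blast
  have c: "c > 0"
    using pos by (simp add: c_def)
  have one: "op_norm_L2 n v = 1"
    using c by (simp add: v_def[abs_def] hom) (simp add: c_def)
  have ext: "mdet n P \<le> op_norm_L2 n (mix n P v) ^ n" for P
  proof -
    have "mix n P v = (\<lambda>i. (1 / c) *\<^sub>R mix n P v0 i)"
      by (simp add: mix_def v_def scaleR_sum_right fun_eq_iff mult.commute)
    then have "op_norm_L2 n (mix n P v) ^ n = op_norm_L2 n (mix n P v0) ^ n / c ^ n"
      using c by (simp add: hom power_divide)
    then show ?thesis
      using ext0[of P] c by (simp add: c_def[symmetric] pos_le_divide_eq)
  qed
  have T: "norm (\<Sum>i<n. a i *\<^sub>R v i) \<le> L2_set a {..<n}" for a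
    using norm_synthesis_le[where a = a and v = v and n = n] by (simp add: one)
  have ball: "(L2_set w {..<n})\<^sup>2 \<le> n" if w: "norm (\<Sum>i<n. w i *\<^sub>R v i) \<le> 1" for w
  proof (rule ccontr)
    define r where "r = L2_set w {..<n}"
    assume "\<not> ?thesis"
    then have r: "r\<^sup>2 > n"
      by (simp add: r_def)
    define B where "B = (\<lambda>(i, j). w i * w j - (if i = j then 1 else 0 :: real))"
    define g where "g s = (1 + (1 + r\<^sup>2) * s\<^sup>2) ^ n -
        mdet n (\<lambda>(i, j). (if i = j then 1 else 0) + s * B (i, j))" for s
    have "(g has_real_derivative 0 - (\<Sum>i<n. B (i, i))) (at 0)"
      unfolding g_def
      by (rule DERIV_diff[OF _ mdet_derivative_at_identity]) (auto intro!: derivative_eq_intros)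
    moreover have "(\<Sum>i<n. B (i, i)) = r\<^sup>2 - n"
      by (simp add: B_def r_def L2_set_power2 sum_subtractf flip: power2_eq_square)
    ultimately have "(g has_real_derivative n - r\<^sup>2) (at 0)"
      by simp
    from DERIV_neg_dec_right[OF this] r
    obtain d where d: "d > 0" "\<And>h. 0 < h \<Longrightarrow> h < d \<Longrightarrow> g (0 + h) < g 0"
      by auto
    define s where "s = min 1 (d / 2)"
    have s: "0 < s" "s < d" "s \<le> 1"
      using d(1) by (auto simp: s_def)
    have "op_norm_L2 n (mix n (\<lambda>(i, j). (if i = j then 1 else 0) + s * B (i, j)) v) \<le>
        1 + (1 + r\<^sup>2) * s\<^sup>2" (is "op_norm_L2 n ?u \<le> _")
    proof (rule op_norm_L2_least)
      fix a assume a: "L2_set a {..<n} \<le> 1"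
      define t where "t = (\<Sum>i<n. a i * w i)"
      have u: "?u i = (1 - s) *\<^sub>R v i + (s * w i) *\<^sub>R (\<Sum>j<n. w j *\<^sub>R v j)" if "i < n" for i
      proof -
        have "(\<Sum>j<n. B (i, j) *\<^sub>R v j) = w i *\<^sub>R (\<Sum>j<n. w j *\<^sub>R v j) - v i"
          using that by (simp add: B_def scaleR_diff_left sum_subtractf scaleR_sum_right
              if_distrib[of "\<lambda>c. c *\<^sub>R _"] cong: if_cong)
        then show ?thesis
          by (simp only: mix_identity_perturbation[OF that]) (simp add: scaleR_diff_left scaleR_diff_right)
      qed
      have "(\<Sum>i<n. a i *\<^sub>R ?u i) =
          (\<Sum>i<n. ((1 - s) * a i) *\<^sub>R v i + (a i * w i) *\<^sub>R (s *\<^sub>R (\<Sum>j<n. w j *\<^sub>R v j)))"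
        by (intro sum.cong) (auto simp: u scaleR_add_right mult_ac)
      also have "\<dots> = (\<Sum>i<n. ((1 - s) * a i) *\<^sub>R v i) + t *\<^sub>R (s *\<^sub>R (\<Sum>j<n. w j *\<^sub>R v j))"
        by (simp only: sum.distrib t_def scaleR_sum_left)
      also have "\<dots> = (\<Sum>i<n. ((1 - s) * a i + s * t * w i) *\<^sub>R v i)"
        by (simp add: scaleR_sum_right scaleR_add_left sum.distrib mult_ac)
      finally show "norm (\<Sum>i<n. a i *\<^sub>R ?u i) \<le> 1 + (1 + r\<^sup>2) * s\<^sup>2"
        using op_norm_L2_second_order[where s = s and n = n and v = v and w = w and a = a] s T w a by (simp add: t_def r_def)
    qed
    moreover have "0 \<le> op_norm_L2 n ?u"
      using norm_synthesis_le_op_norm[of "\<lambda>i. 0" n ?u] by (simp add: L2_set_def)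
    ultimately have "op_norm_L2 n ?u ^ n \<le> (1 + (1 + r\<^sup>2) * s\<^sup>2) ^ n"
      by (rule power_mono)
    then have "0 \<le> g s"
      using ext[of "\<lambda>(i, j). (if i = j then 1 else 0) + s * B (i, j)"] by (simp add: g_def)
    moreover have "g 0 = 0"
      by (simp add: g_def mdet_identity)
    ultimately show False
      using d(2)[of s] s by simp
  qed
  have "euclidean_frame n (sqrt n) V v"
    unfolding euclidean_frame_def
  proof (intro conjI allI ballI T)
    fix x assume "x \<in> V"
    then obtain a0 where a0: "x = (\<Sum>i<n. a0 i *\<^sub>R v0 i)"
      using span0 by blast
    define a where "a i = c * a0 i" for i
    have x: "(\<Sum>i<n. a i *\<^sub>R v i) = x"
      using c by (simp add: a_def v_def a0)
    \<comment> \<open>Multiples \<open>b x\<close> in the unit ball bound \<open>|a|\<close>; for \<open>x = 0\<close> all multiples are admissible, hence \<open>a = 0\<close>.\<close>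
    have scaled: "\<bar>b\<bar> * L2_set a {..<n} \<le> sqrt n" if "\<bar>b\<bar> * norm x \<le> 1" for b
    proof -
      have "(\<Sum>i<n. (b * a i) *\<^sub>R v i) = b *\<^sub>R x"
        by (simp add: scaleR_sum_right flip: x)
      then have "(L2_set (\<lambda>i. b * a i) {..<n})\<^sup>2 \<le> n"
        using that by (intro ball) simp
      then show ?thesis
        by (simp add: L2_set_scale real_le_rsqrt)
    qed
    have "L2_set a {..<n} \<le> sqrt n * norm x"
    proof (cases "x = 0")
      case True
      have "L2_set a {..<n} = 0"
      proof (rule ccontr)
        assume "L2_set a {..<n} \<noteq> 0"
        then have "L2_set a {..<n} > 0"
          by (simp add: order_less_le)
        then show False
          using scaled[of "(sqrt n + 1) / L2_set a {..<n}"] True by simp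
      qed
      then show ?thesis
        by (simp add: True)
    next
      case False
      then show ?thesis
        using scaled[of "1 / norm x"] by (simp add: divide_le_eq)
    qed
    with x show "\<exists>a. (\<Sum>i<n. a i *\<^sub>R v i) = x \<and> L2_set a {..<n} \<le> sqrt n * norm x"
      by blast
  qed
  then show ?thesis by blast
qed

section \<open>Pointwise and integral inequalities\<close>

lemma powr_minus_two_mult_power2:
  fixes X q :: real
  assumes "0 \<le> X"
  shows "X powr (q - 2) * X\<^sup>2 = X powr q"
proof (cases "X = 0")
  case False
  then have "X powr (q - 2) * X powr 2 = X powr q"
    by (simp flip: powr_add)
  then show ?thesis
    using False assms by simp
qed simp

text \<open>
  For negative \<open>y = - z\<close> the inequality follows from \<open>exp z \<ge> 1 + z\<close> and
  \<open>(1 - z + z\<^sup>2)(1 + z) = 1 + z\<^sup>3\<close>.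
\<close>

lemma exp_le_quadratic:
  fixes y :: real
  assumes "\<bar>y\<bar> \<le> 1"
  shows "exp y \<le> 1 + y + y\<^sup>2"
proof (cases "y \<ge> 0")
  case True
  then show ?thesis
    using assms by (intro exp_bound) auto
next
  case False
  define z where "z = - y"
  have z: "0 < z"
    using False by (simp add: z_def)
  have "1 \<le> (1 - z + z\<^sup>2) * (1 + z)"
    using z by (simp add: power2_eq_square algebra_simps)
  also have "\<dots> \<le> (1 - z + z\<^sup>2) * exp z"
  proof (rule mult_left_mono)
    have "0 \<le> 1 - z" if "z \<le> 1"
      using that by simp
    then show "0 \<le> 1 - z + z\<^sup>2"
      using assms by (simp add: z_def)
  qed simp
  finally show ?thesis
    by (simp add: z_def exp_minus field_simps)
qed

lemma one_plus_powr_le: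
  fixes \<tau> r :: real
  assumes "0 \<le> 1 + \<tau>" "0 \<le> r" "\<bar>r * \<tau>\<bar> \<le> 1"
  shows "(1 + \<tau>) powr r \<le> 1 + r * \<tau> + (r * \<tau>)\<^sup>2"
proof (cases "1 + \<tau> = 0")
  case True
  have "0 \<le> 1 + r * \<tau>"
    using assms(3) by linarith
  then show ?thesis
    by (simp add: True)
next
  case False
  then have "r * ln (1 + \<tau>) \<le> r * \<tau>"
    using assms ln_add_one_self_le_self2[of \<tau>] by (intro mult_left_mono) auto
  then have "(1 + \<tau>) powr r \<le> exp (r * \<tau>)"
    using False assms(1) by (simp add: powr_def)
  then show ?thesis
    using exp_le_quadratic[OF assms(3)] by linarith
qed

text \<open>
  The expansion of \<open>|x|\<^sup>q\<close> when \<open>s \<sigma> x\<^sub>j\<close> is added to the \<open>i\<close>-th coordinate. The remainder is a multiple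
  of \<open>s\<^sup>2 |x|\<^sup>q\<close> with a constant independent of \<open>x\<close>, so the inequality can be integrated
  term by term. It stays valid for \<open>x = 0\<close>, where both sides are \<open>0\<close>.
\<close>

lemma L2_set_powr_perturb:
  fixes x :: "nat \<Rightarrow> real"
  assumes i: "i < n" and j: "j < n" and \<sigma>: "\<bar>\<sigma>\<bar> = 1" and q: "q > 0"
    and s: "0 \<le> s" "s \<le> 1" "3 * q * s \<le> 2"
  defines "X \<equiv> L2_set x {..<n}"
  shows "L2_set (\<lambda>k. x k + (if k = i then s * \<sigma> else 0) * x j) {..<n} powr q \<le>
    X powr q + q * s * \<sigma> * (x i * x j * X powr (q - 2)) + (q + 3 * q\<^sup>2) * s\<^sup>2 * X powr q"
proof (cases "X = 0")
  case True
  then have "\<forall>k<n. x k = 0"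
    by (simp add: X_def L2_set_eq_0_iff)
  then show ?thesis
    using i j by (simp add: L2_set_def X_def)
next
  case False
  then have X: "X > 0"
    unfolding X_def by (simp add: order_less_le)
  define Y where "Y = L2_set (\<lambda>k. x k + (if k = i then s * \<sigma> else 0) * x j) {..<n}"
  \<comment> \<open>The relative change of the squared length.\<close>
  define \<tau> where "\<tau> = (2 * s * \<sigma> * (x i * x j) + s\<^sup>2 * (x j)\<^sup>2) / X\<^sup>2"
  have \<sigma>2: "\<sigma>\<^sup>2 = 1"
    using \<sigma> by (metis power2_abs power_one)
  have "Y\<^sup>2 = X\<^sup>2 + 2 * (s * \<sigma> * x j) * x i + (s * \<sigma> * x j)\<^sup>2"
  proof -
    have "Y = L2_set (\<lambda>k. 1 * x k + (s * \<sigma> * x j) * (if k = i then 1 else 0)) {..<n}"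
      unfolding Y_def by (rule L2_set_cong) auto
    then have "Y\<^sup>2 = 1\<^sup>2 * X\<^sup>2 + 2 * 1 * (s * \<sigma> * x j) * (\<Sum>k<n. x k * (if k = i then 1 else 0)) +
        (s * \<sigma> * x j)\<^sup>2 * (L2_set (\<lambda>k. if k = i then 1 else 0) {..<n})\<^sup>2"
      unfolding X_def by (simp only: L2_set_lincomb_power2)
    moreover have "(\<Sum>k<n. x k * (if k = i then 1 else 0)) = x i"
      using i by (simp add: if_distrib[of "\<lambda>c. _ * c"] cong: if_cong)
    moreover have "(L2_set (\<lambda>k. if k = i then 1 else 0) {..<n})\<^sup>2 = 1"
      using i by (simp add: L2_set_power2 if_distrib[of "\<lambda>c. c\<^sup>2"] cong: if_cong)
    ultimately show ?thesis
      by simp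
  qed
  then have Y2: "Y\<^sup>2 = X\<^sup>2 * (1 + \<tau>)"
  proof -
    have "X\<^sup>2 * (1 + e / X\<^sup>2) = X\<^sup>2 + e" for e
      using X by (simp add: distrib_left)
    then show ?thesis
      using \<open>Y\<^sup>2 = _\<close> \<sigma>2 unfolding \<tau>_def by (simp add: power_mult_distrib mult_ac)
  qed
  have "0 \<le> X\<^sup>2 * (1 + \<tau>)"
    unfolding Y2[symmetric] by simp
  then have \<tau>1: "0 \<le> 1 + \<tau>"
    using X by (simp add: zero_le_mult_iff)
  have xi: "\<bar>x i\<bar> \<le> X" and xj: "\<bar>x j\<bar> \<le> X"
    unfolding X_def using i j by (auto intro: abs_le_L2_set)
  have xij: "\<bar>x i * x j\<bar> \<le> X\<^sup>2"
    unfolding abs_mult power2_eq_square using xi xj by (intro mult_mono) auto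
  have xjj: "(x j)\<^sup>2 \<le> X\<^sup>2"
    using xj X by (simp add: abs_le_square_iff[symmetric])
  have "\<bar>2 * s * \<sigma> * (x i * x j) + s\<^sup>2 * (x j)\<^sup>2\<bar> \<le> 2 * s * X\<^sup>2 + s * X\<^sup>2"
  proof (rule order_trans[OF abs_triangle_ineq add_mono])
    show "\<bar>2 * s * \<sigma> * (x i * x j)\<bar> \<le> 2 * s * X\<^sup>2"
      using s \<sigma> xij by (simp add: abs_mult mult_left_mono)
    have "s\<^sup>2 * (x j)\<^sup>2 \<le> s * X\<^sup>2"
      using s xjj by (intro mult_mono) (auto simp: power2_eq_square mult_left_le)
    then show "\<bar>s\<^sup>2 * (x j)\<^sup>2\<bar> \<le> s * X\<^sup>2"
      by simp
  qed
  then have "\<bar>\<tau>\<bar> \<le> 3 * s"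
    using X by (simp add: \<tau>_def abs_divide divide_le_eq algebra_simps)
  then have q\<tau>: "\<bar>q / 2 * \<tau>\<bar> \<le> q / 2 * (3 * s)"
    using q by (simp add: abs_mult mult_left_mono)
  have "Y powr q = (Y\<^sup>2) powr (q / 2)"
    using powr_powr[of Y 2 "q / 2"] by (simp add: Y_def)
  also have "\<dots> = X powr q * (1 + \<tau>) powr (q / 2)"
    using powr_powr[of X 2 "q / 2"] X by (simp add: Y2 powr_mult)
  also have "\<dots> \<le> X powr q * (1 + q / 2 * \<tau> + (q / 2 * \<tau>)\<^sup>2)"
    using \<tau>1 q q\<tau> s by (intro mult_left_mono one_plus_powr_le) auto
  also have "\<dots> \<le> X powr q * (1 + q / 2 * \<tau> + (q / 2 * (3 * s))\<^sup>2)"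
    using power_mono[OF q\<tau> abs_ge_zero, of 2, unfolded power2_abs]
    by (intro mult_left_mono add_left_mono) auto
  also have "\<dots> = X powr q + q / 2 * (X powr q * \<tau>) + (q / 2 * (3 * s))\<^sup>2 * X powr q"
    by (simp add: algebra_simps)
  also have "X powr q * \<tau> = X powr (q - 2) * (2 * s * \<sigma> * (x i * x j) + s\<^sup>2 * (x j)\<^sup>2)"
  proof -
    have "X powr q = X powr (q - 2) * X\<^sup>2"
      using X by (simp add: powr_minus_two_mult_power2)
    then show ?thesis
      using X by (simp only: \<tau>_def) simp
  qed
  also have "X powr q + q / 2 * \<dots> + (q / 2 * (3 * s))\<^sup>2 * X powr q =
      X powr q + q * s * \<sigma> * (x i * x j * X powr (q - 2)) +
      (q / 2 * s\<^sup>2 * (X powr (q - 2) * (x j)\<^sup>2) + 9 / 4 * q\<^sup>2 * s\<^sup>2 * X powr q)"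
    by (simp add: power2_eq_square algebra_simps)
  also have "\<dots> \<le> X powr q + q * s * \<sigma> * (x i * x j * X powr (q - 2)) +
      (q * s\<^sup>2 * X powr q + 3 * q\<^sup>2 * s\<^sup>2 * X powr q)"
  proof (intro add_left_mono add_mono)
    have "X powr (q - 2) * (x j)\<^sup>2 \<le> X powr (q - 2) * X\<^sup>2"
      using xjj by (intro mult_left_mono) auto
    also have "\<dots> = X powr q"
      using X by (intro powr_minus_two_mult_power2) simp
    finally show "q / 2 * s\<^sup>2 * (X powr (q - 2) * (x j)\<^sup>2) \<le> q * s\<^sup>2 * X powr q"
      using q by (intro mult_mono) auto
    show "9 / 4 * q\<^sup>2 * s\<^sup>2 * X powr q \<le> 3 * q\<^sup>2 * s\<^sup>2 * X powr q"
      by (intro mult_right_mono) auto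
  qed
  finally show ?thesis
    by (simp add: Y_def algebra_simps)
qed

text \<open>
  Hoelder's inequality with exponents \<open>1/\<theta>\<close> and \<open>1/(1 - \<theta>)\<close>, by integrating Young's inequality
  for the normalized functions \<open>G / \<integral>G\<close> and \<open>H / \<integral>H\<close>.
\<close>

lemma integral_powr_mult_powr_le:
  fixes G H :: "'b \<Rightarrow> real"
  assumes G: "integrable M G" "\<And>t. 0 \<le> G t" and H: "integrable M H" "\<And>t. 0 \<le> H t"
    and \<theta>: "0 \<le> \<theta>" "\<theta> \<le> 1"
    and pos: "0 < (LINT t|M. G t)" "0 < (LINT t|M. H t)"
  shows "(LINT t|M. G t powr \<theta> * H t powr (1 - \<theta>)) \<le>
    (LINT t|M. G t) powr \<theta> * (LINT t|M. H t) powr (1 - \<theta>)"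
proof -
  define g h where "g = (LINT t|M. G t)" and "h = (LINT t|M. H t)"
  have gh: "g > 0" "h > 0"
    using pos by (auto simp: g_def h_def)
  define c where "c = g powr \<theta> * h powr (1 - \<theta>)"
  have c: "c > 0"
    using gh by (simp add: c_def)
  have young: "G t powr \<theta> * H t powr (1 - \<theta>) \<le> c * (\<theta> * (G t / g) + (1 - \<theta>) * (H t / h))" for t
  proof (cases "G t = 0 \<or> H t = 0")
    case True
    have "0 \<le> c * (\<theta> * (G t / g) + (1 - \<theta>) * (H t / h))"
      using c gh G(2)[of t] H(2)[of t] \<theta> by simp
    then show ?thesis
      using True by auto
  next
    case False
    then have "G t > 0" "H t > 0"
      using G(2)[of t] H(2)[of t] by auto
    then have "(G t / g) powr \<theta> * (H t / h) powr (1 - \<theta>) \<le> \<theta> * (G t / g) + (1 - \<theta>) * (H t / h)"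
      using gh \<theta> by (intro Youngs_inequality_0) auto
    then have "c * ((G t / g) powr \<theta> * (H t / h) powr (1 - \<theta>)) \<le>
        c * (\<theta> * (G t / g) + (1 - \<theta>) * (H t / h))"
      using c by (intro mult_left_mono) auto
    also have "c * ((G t / g) powr \<theta> * (H t / h) powr (1 - \<theta>)) =
        (g * (G t / g)) powr \<theta> * (h * (H t / h)) powr (1 - \<theta>)"
      unfolding c_def powr_mult by (simp only: mult_ac)
    finally show ?thesis
      using gh by simp
  qed
  have "(LINT t|M. G t powr \<theta> * H t powr (1 - \<theta>)) \<le>
      (LINT t|M. c * (\<theta> * (G t / g) + (1 - \<theta>) * (H t / h)))"
  proof (rule integral_mono_AE')
    show "integrable M (\<lambda>t. c * (\<theta> * (G t / g) + (1 - \<theta>) * (H t / h)))"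
      using G(1) H(1) by auto
    show "AE t in M. 0 \<le> c * (\<theta> * (G t / g) + (1 - \<theta>) * (H t / h))"
      using c gh G(2) H(2) \<theta> by auto
  qed (use young in auto)
  also have "\<dots> = c * (\<theta> * (g / g) + (1 - \<theta>) * (h / h))"
    using G(1) H(1) by (simp add: g_def h_def)
  also have "\<dots> = c"
    using gh by simp
  finally show ?thesis
    by (simp add: c_def g_def h_def)
qed

section \<open>Lewis's theorem\<close>

lemma powr_base_inject:
  fixes x y q :: real
  assumes "x powr q = y powr q" "0 \<le> x" "0 \<le> y" "0 < q"
  shows "x = y"
  using assms powr_less_mono2[of q x y] powr_less_mono2[of q y x] by linarith

locale Lq_space =
  fixes q :: real and M :: "'b measure" and J :: "'a::real_normed_vector \<Rightarrow> 'b \<Rightarrow> real"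
  assumes q: "1 \<le> q" and Lp: "is_Lp_space (ennreal q) M J"
begin

lemma measurable_J [measurable]: "J x \<in> borel_measurable M"
  using Lp by (auto simp: is_Lp_space_def Lp_functions_def)

lemma integrable_J: "integrable M (\<lambda>t. \<bar>J x t\<bar> powr q)"
proof -
  have "J x \<in> Lp_functions (ennreal q) M"
    using Lp by (simp add: is_Lp_space_def)
  then show ?thesis
    using q by (simp add: Lp_functions_def)
qed

lemma norm_powr: "norm x powr q = (LINT t|M. \<bar>J x t\<bar> powr q)"
proof -
  have "norm x = (LINT t|M. \<bar>J x t\<bar> powr q) powr (1 / q)"
    using Lp q by (simp add: is_Lp_space_def Lp_norm_def)
  moreover have "0 \<le> (LINT t|M. \<bar>J x t\<bar> powr q)"
    by (rule integral_nonneg_AE) simp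
  ultimately show ?thesis
    using q by (simp add: powr_powr)
qed

lemma J_surj:
  assumes "f \<in> borel_measurable M" "integrable M (\<lambda>t. \<bar>f t\<bar> powr q)"
  shows "\<exists>x. AE t in M. J x t = f t"
proof -
  have "f \<in> Lp_functions (ennreal q) M"
    using assms q by (simp add: Lp_functions_def)
  then show ?thesis
    using Lp unfolding is_Lp_space_def by blast
qed

lemma AE_J_add: "AE t in M. J (x + y) t = J x t + J y t"
  using Lp by (simp add: is_Lp_space_def)

lemma AE_J_scale: "AE t in M. J (c *\<^sub>R x) t = c * J x t"
  using Lp by (simp add: is_Lp_space_def)

lemma AE_J_add_scale: "AE t in M. J (x + c *\<^sub>R y) t = J x t + c * J y t"
  using AE_J_add[of x "c *\<^sub>R y"] AE_J_scale[of c y] by eventually_elim simp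

lemma AE_J_diff: "AE t in M. J (x - y) t = J x t - J y t"
  using AE_J_add_scale[of x "-1" y] by simp

lemma AE_J_sum:
  assumes "finite A"
  shows "AE t in M. J (\<Sum>i\<in>A. a i *\<^sub>R v i) t = (\<Sum>i\<in>A. a i * J (v i) t)"
  using assms
proof induction
  case empty
  then show ?case
    using AE_J_scale[of 0 0] by simp
next
  case (insert i A)
  have "AE t in M. J (a i *\<^sub>R v i + (\<Sum>i\<in>A. a i *\<^sub>R v i)) t =
      J (a i *\<^sub>R v i) t + J (\<Sum>i\<in>A. a i *\<^sub>R v i) t"
    by (rule AE_J_add)
  with insert.IH AE_J_scale[of "a i" "v i"] show ?case
    by eventually_elim (use insert.hyps in simp)
qed

lemma norm_le_if_AE_abs_le:
  assumes "AE t in M. \<bar>J x t\<bar> \<le> \<bar>J y t\<bar>"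
  shows "norm x \<le> norm y"
proof -
  have "AE t in M. \<bar>J x t\<bar> powr q \<le> \<bar>J y t\<bar> powr q"
    using assms by eventually_elim (use q in \<open>auto intro: powr_mono2\<close>)
  then have "norm x powr q \<le> norm y powr q"
    unfolding norm_powr by (intro integral_mono_AE integrable_J)
  then show ?thesis
    using q powr_less_mono2[of q "norm y" "norm x"] by force
qed

lemma integrable_powr_if_dominated:
  assumes [measurable]: "f \<in> borel_measurable M" and "AE t in M. \<bar>f t\<bar> \<le> \<bar>J y t\<bar>"
  shows "integrable M (\<lambda>t. \<bar>f t\<bar> powr q)"
proof (rule Bochner_Integration.integrable_bound[OF integrable_J[of y]])
  show "AE t in M. norm (\<bar>f t\<bar> powr q) \<le> norm (\<bar>J y t\<bar> powr q)"
    using assms(2) by eventually_elim (use q in \<open>auto intro: powr_mono2\<close>)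
qed measurable

lemma ex_abs: "\<exists>u. (AE t in M. J u t = \<bar>J x t\<bar>) \<and> norm u = norm x"
proof -
  obtain u where u: "AE t in M. J u t = \<bar>J x t\<bar>"
    using J_surj[of "\<lambda>t. \<bar>J x t\<bar>"] integrable_J[of x] by auto
  then have "norm u = norm x"
    by (intro antisym norm_le_if_AE_abs_le) auto
  with u show ?thesis by blast
qed

text \<open>
  The square function \<open>F\<close> of a tuple of elements of \<open>L\<^sub>q\<close>.
\<close>

definition sq_fun :: "nat \<Rightarrow> (nat \<Rightarrow> 'a) \<Rightarrow> 'b \<Rightarrow> real" where
  "sq_fun n v t = L2_set (\<lambda>i. J (v i) t) {..<n}"

lemma sq_fun_nonneg [simp]: "0 \<le> sq_fun n v t"
  by (simp add: sq_fun_def)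

lemma measurable_sq_fun [measurable]: "sq_fun n v \<in> borel_measurable M"
  unfolding sq_fun_def[abs_def] L2_set_def by measurable

text \<open>
  Minkowski's inequality for \<open>L\<^sub>q\<close> comes for free: the space is normed, and \<open>J\<close> is onto, so the sum
  of the absolute values is represented by an element whose norm obeys the triangle inequality.
\<close>

lemma ex_sum_abs:
  fixes n :: nat
  shows
  "\<exists>y. (AE t in M. J y t = (\<Sum>i<n. \<bar>J (v i) t\<bar>)) \<and> norm y \<le> (\<Sum>i<n. norm (v i))"
proof -
  obtain u where u: "\<And>i. AE t in M. J (u i) t = \<bar>J (v i) t\<bar>" "\<And>i. norm (u i) = norm (v i)"
    using ex_abs[of "v _"] by metis
  have "AE t in M. \<forall>i\<in>{..<n}. J (u i) t = \<bar>J (v i) t\<bar>"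
    using u(1) by (intro AE_finite_allI) auto
  moreover have "AE t in M. J (\<Sum>i<n. 1 *\<^sub>R u i) t = (\<Sum>i<n. 1 * J (u i) t)"
    by (rule AE_J_sum) simp
  ultimately have "AE t in M. J (\<Sum>i<n. u i) t = (\<Sum>i<n. \<bar>J (v i) t\<bar>)"
    by eventually_elim simp
  moreover have "norm (\<Sum>i<n. u i) \<le> (\<Sum>i<n. norm (v i))"
    using norm_sum[of u "{..<n}"] by (simp add: u(2))
  ultimately show ?thesis by blast
qed

lemma integrable_sq_fun: "integrable M (\<lambda>t. sq_fun n v t powr q)"
proof -
  obtain y where "AE t in M. J y t = (\<Sum>i<n. \<bar>J (v i) t\<bar>)"
    using ex_sum_abs[where n = n and v = v] by blast
  then have "AE t in M. \<bar>sq_fun n v t\<bar> \<le> \<bar>J y t\<bar>"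
    by eventually_elim (auto simp: sq_fun_def L2_set_le_sum_abs sum_nonneg)
  then show ?thesis
    using integrable_powr_if_dominated[of "sq_fun n v" y] by simp
qed

text \<open>
  The norm of a tuple in \<open>L\<^sub>q(\<ell>\<^sub>2\<^sup>n)\<close>.
\<close>

definition sq_norm :: "nat \<Rightarrow> (nat \<Rightarrow> 'a) \<Rightarrow> real" where
  "sq_norm n v = (LINT t|M. sq_fun n v t powr q) powr (1 / q)"

lemma sq_norm_powr: "sq_norm n v powr q = (LINT t|M. sq_fun n v t powr q)"
proof -
  have "0 \<le> (LINT t|M. sq_fun n v t powr q)"
    by (rule integral_nonneg_AE) simp
  then show ?thesis
    using q by (simp add: sq_norm_def powr_powr)
qed

lemma sq_norm_nonneg [simp]: "0 \<le> sq_norm n v"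
  by (simp add: sq_norm_def)

lemma ex_sq_norm: "\<exists>x. (AE t in M. J x t = sq_fun n v t) \<and> norm x = sq_norm n v"
proof -
  obtain x where x: "AE t in M. J x t = sq_fun n v t"
    using J_surj[of "sq_fun n v"] integrable_sq_fun[of n v] by auto
  have "AE t in M. \<bar>J x t\<bar> powr q = sq_fun n v t powr q"
    using x by eventually_elim simp
  then have "norm x powr q = sq_norm n v powr q"
    unfolding norm_powr sq_norm_powr by (intro integral_cong_AE) measurable
  then have "norm x = sq_norm n v"
    by (rule powr_base_inject) (use q in simp_all)
  with x show ?thesis by blast
qed

text \<open>
  Pointwise, two square functions differ by at most \<open>\<Sum>\<^sub>i |v\<^sub>i - w\<^sub>i|\<close>, so their representatives differ
  in norm by at most \<open>\<Sum>\<^sub>i \<parallel>v\<^sub>i - w\<^sub>i\<parallel>\<close>; and \<open>F\<close> dominates each \<open>|v\<^sub>i|\<close>.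
\<close>

lemma tuple_norm_sq_norm: "tuple_norm n (sq_norm n)"
  unfolding tuple_norm_def
proof (intro conjI allI impI)
  fix v w :: "nat \<Rightarrow> 'a"
  obtain x where x: "AE t in M. J x t = sq_fun n v t" "norm x = sq_norm n v"
    using ex_sq_norm by blast
  obtain y where y: "AE t in M. J y t = sq_fun n w t" "norm y = sq_norm n w"
    using ex_sq_norm by blast
  obtain z where z: "AE t in M. J z t = (\<Sum>i<n. \<bar>J (v i - w i) t\<bar>)"
      "norm z \<le> (\<Sum>i<n. norm (v i - w i))"
    using ex_sum_abs[where n = n and v = "\<lambda>i. v i - w i"] by blast
  have "AE t in M. \<forall>i\<in>{..<n}. J (v i - w i) t = J (v i) t - J (w i) t"
    using AE_J_diff by (intro AE_finite_allI) auto
  with x(1) y(1) z(1) AE_J_diff[of x y] have "AE t in M. \<bar>J (x - y) t\<bar> \<le> \<bar>J z t\<bar>"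
  proof eventually_elim
    case (elim t)
    define f g where "f i = J (v i) t" and "g i = J (w i) t" for i
    have "L2_set f {..<n} \<le> L2_set (\<lambda>i. f i - g i) {..<n} + L2_set g {..<n}"
      using L2_set_triangle_ineq[of "\<lambda>i. f i - g i" g "{..<n}"] by simp
    moreover have "L2_set g {..<n} \<le> L2_set (\<lambda>i. f i - g i) {..<n} + L2_set f {..<n}"
      using L2_set_triangle_ineq[of "\<lambda>i. - 1 * (f i - g i)" f "{..<n}"]
      by (simp only: L2_set_scale) simp
    moreover have "L2_set (\<lambda>i. f i - g i) {..<n} \<le> (\<Sum>i<n. \<bar>f i - g i\<bar>)"
      by (rule L2_set_le_sum_abs)
    ultimately have "\<bar>L2_set f {..<n} - L2_set g {..<n}\<bar> \<le> (\<Sum>i<n. \<bar>f i - g i\<bar>)"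
      by linarith
    then show ?case
      using elim by (simp add: sq_fun_def f_def[abs_def] g_def[abs_def])
  qed
  then have "norm (x - y) \<le> norm z"
    by (rule norm_le_if_AE_abs_le)
  then show "\<bar>sq_norm n v - sq_norm n w\<bar> \<le> (\<Sum>i<n. norm (v i - w i))"
    using norm_triangle_ineq3[of x y] x(2) y(2) z(2) by simp
next
  fix c and v :: "nat \<Rightarrow> 'a"
  have "AE t in M. \<forall>i\<in>{..<n}. J (c *\<^sub>R v i) t = c * J (v i) t"
    using AE_J_scale by (intro AE_finite_allI) auto
  then have "AE t in M. sq_fun n (\<lambda>i. c *\<^sub>R v i) t = \<bar>c\<bar> * sq_fun n v t"
    by eventually_elim (simp add: sq_fun_def L2_set_scale cong: L2_set_cong_simp)
  then have "AE t in M. sq_fun n (\<lambda>i. c *\<^sub>R v i) t powr q = \<bar>c\<bar> powr q * sq_fun n v t powr q"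
    by eventually_elim (simp add: powr_mult)
  then have "sq_norm n (\<lambda>i. c *\<^sub>R v i) powr q = (LINT t|M. \<bar>c\<bar> powr q * sq_fun n v t powr q)"
    unfolding sq_norm_powr by (intro integral_cong_AE) measurable
  also have "\<dots> = (\<bar>c\<bar> * sq_norm n v) powr q"
    by (simp add: powr_mult sq_norm_powr)
  finally show "sq_norm n (\<lambda>i. c *\<^sub>R v i) = \<bar>c\<bar> * sq_norm n v"
    by (rule powr_base_inject) (use q in simp_all)
next
  fix v :: "nat \<Rightarrow> 'a"
  assume "\<exists>i<n. v i \<noteq> 0"
  then obtain i where i: "i < n" "v i \<noteq> 0"
    by blast
  obtain x where x: "AE t in M. J x t = sq_fun n v t" "norm x = sq_norm n v"
    using ex_sq_norm by blast
  have "AE t in M. \<bar>J (v i) t\<bar> \<le> \<bar>J x t\<bar>"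
    using x(1)
    by eventually_elim (use i in \<open>auto simp: sq_fun_def intro: abs_le_L2_set\<close>)
  then have "norm (v i) \<le> norm x"
    by (rule norm_le_if_AE_abs_le)
  then show "0 < sq_norm n v"
    using i(2) x(2) by (metis less_le_trans zero_less_norm_iff)
qed

text \<open>
  The integrand of the inner product of \<open>v\<^sub>i\<close> and \<open>v\<^sub>j\<close> with weight \<open>F\<^bsup>q-2\<^esup>\<close>. Where \<open>F\<close> vanishes all
  \<open>v\<^sub>i\<close> vanish too, so the value of the power at \<open>0\<close> is harmless.
\<close>

definition moment :: "nat \<Rightarrow> (nat \<Rightarrow> 'a) \<Rightarrow> nat \<Rightarrow> nat \<Rightarrow> 'b \<Rightarrow> real" where
  "moment n v i j t = J (v i) t * J (v j) t * sq_fun n v t powr (q - 2)"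

lemma integrable_moment:
  assumes "i < n" "j < n"
  shows "integrable M (moment n v i j)"
proof (rule Bochner_Integration.integrable_bound[OF integrable_sq_fun[of n v]])
  show "moment n v i j \<in> borel_measurable M"
    unfolding moment_def[abs_def] by measurable
  show "AE t in M. norm (moment n v i j t) \<le> norm (sq_fun n v t powr q)"
  proof (rule AE_I2)
    fix t
    have "\<bar>J (v i) t\<bar> * \<bar>J (v j) t\<bar> \<le> sq_fun n v t * sq_fun n v t"
      unfolding sq_fun_def using assms by (intro mult_mono abs_le_L2_set) auto
    then have "\<bar>J (v i) t\<bar> * \<bar>J (v j) t\<bar> * sq_fun n v t powr (q - 2) \<le>
        (sq_fun n v t)\<^sup>2 * sq_fun n v t powr (q - 2)"
      unfolding power2_eq_square by (rule mult_right_mono) simp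
    also have "\<dots> = sq_fun n v t powr q"
      using powr_minus_two_mult_power2[of "sq_fun n v t" q] by (simp add: mult.commute)
    finally show "norm (moment n v i j t) \<le> norm (sq_fun n v t powr q)"
      by (simp add: moment_def abs_mult)
  qed
qed

text \<open>
  Perturb an extremal tuple by \<open>I + s \<sigma> E\<^sub>i\<^sub>j\<close> with \<open>\<sigma> = \<plusminus>1\<close>, where \<open>E\<^sub>i\<^sub>j\<close> is a matrix unit. To
  first order \<open>\<integral>F\<^sup>q\<close> changes by at most \<open>q s \<sigma> m\<close>, with \<open>m\<close> the \<open>(i, j)\<close> moment, and extremality
  bounds this change below by the change of \<open>det\<^bsup>q/n\<^esup> \<integral>F\<^sup>q\<close>, which is \<open>(q/n) s \<sigma> \<delta>\<^sub>i\<^sub>j \<integral>F\<^sup>q\<close>. The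
  two signs together give equality.
\<close>

lemma moment_eq_if_extremal:
  assumes ext: "\<And>P. mdet n P * sq_norm n v ^ n \<le> sq_norm n (mix n P v) ^ n"
    and pos: "sq_norm n v > 0" and n: "n \<ge> 1" and ij: "i < n" "j < n"
  shows "(LINT t|M. moment n v i j t) = (if i = j then sq_norm n v powr q / n else 0)"
proof -
  define A where "A = sq_norm n v powr q"
  have A: "A > 0"
    using pos by (simp add: A_def)
  define m where "m = (LINT t|M. moment n v i j t)"
  define \<delta> :: real where "\<delta> = (if i = j then 1 else 0)"
  have ge: "\<sigma> * \<delta> / n \<le> \<sigma> * m / A" if \<sigma>: "\<bar>\<sigma>\<bar> = 1" for \<sigma> :: real
  proof (rule ccontr)
    assume "\<not> ?thesis"
    then have "q * (\<sigma> * m / A) < q * (\<sigma> * \<delta> / n)"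
      using q by (intro mult_strict_left_mono) auto
    then have neg: "q * \<sigma> * m / A - q / n * (\<sigma> * \<delta>) < 0"
      by (simp add: mult_ac)
    define B :: "nat \<times> nat \<Rightarrow> real" where "B = (\<lambda>(k, l). if k = i \<and> l = j then \<sigma> else 0)"
    define P where "P s = (\<lambda>(k, l). (if k = l then 1 else 0) + s * B (k, l))" for s
    define \<kappa> where "\<kappa> = q + 3 * q\<^sup>2"
    \<comment> \<open>Extremality says \<open>g s \<ge> 0\<close> for small positive \<open>s\<close>, but \<open>g 0 = 0\<close> and \<open>g\<close> has negative slope at \<open>0\<close>.\<close>
    define g where "g s = 1 + q * s * \<sigma> * m / A + \<kappa> * s\<^sup>2 - mdet n (P s) powr (q / n)" for s
    have trB: "(\<Sum>k<n. B (k, k)) = \<sigma> * \<delta>"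
      using ij by (cases "i = j") (auto simp: B_def \<delta>_def intro!: sum.neutral)
    have dP: "((\<lambda>s. mdet n (P s)) has_real_derivative \<sigma> * \<delta>) (at 0)"
      unfolding P_def trB[symmetric] by (rule mdet_derivative_at_identity)
    have P0: "mdet n (P 0) = 1"
      by (simp add: P_def mdet_identity)
    have "((\<lambda>s. mdet n (P s) powr (q / n)) has_real_derivative q / n * (\<sigma> * \<delta>)) (at 0)"
      using DERIV_fun_powr[OF dP, of "q / n"] by (simp add: P0)
    moreover have "((\<lambda>s. 1 + q * s * \<sigma> * m / A + \<kappa> * s\<^sup>2) has_real_derivative q * \<sigma> * m / A) (at 0)"
      using A by (auto intro!: derivative_eq_intros)
    ultimately have "(g has_real_derivative q * \<sigma> * m / A - q / n * (\<sigma> * \<delta>)) (at 0)"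
      unfolding g_def by (rule DERIV_diff[rotated])
    from DERIV_neg_dec_right[OF this neg]
    obtain d1 where d1: "d1 > 0" "\<And>h. 0 < h \<Longrightarrow> h < d1 \<Longrightarrow> g (0 + h) < g 0"
      by auto
    have "((\<lambda>s. mdet n (P s)) \<longlongrightarrow> 1) (at 0)"
      using DERIV_isCont[OF dP] by (simp add: isCont_def P0)
    then have "\<forall>\<^sub>F s in at 0. mdet n (P s) > 0"
      by (rule order_tendstoD) simp
    then obtain d2 where d2: "d2 > 0" "\<And>s. s \<noteq> 0 \<Longrightarrow> \<bar>s\<bar> < d2 \<Longrightarrow> mdet n (P s) > 0"
      by (auto simp: eventually_at dist_real_def)
    define s where "s = min (min (d1 / 2) (d2 / 2)) (2 / (3 * q))"
    have s: "0 < s" "s < d1" "s < d2" "s \<le> 2 / (3 * q)"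
      using d1 d2 q by (auto simp: s_def)
    have "3 * q * s \<le> 2"
      using s(4) q by (simp add: field_simps)
    moreover have "2 / (3 * q) \<le> 1"
      using q by simp
    ultimately have s': "3 * q * s \<le> 2" "s \<le> 1"
      using s(4) by auto
    have det: "mdet n (P s) > 0"
      using d2(2)[of s] s by simp
    define u where "u k = v k + (if k = i then s * \<sigma> else 0) *\<^sub>R v j" for k
    have "mix n (P s) v k = u k" if "k < n" for k
    proof -
      have "(\<Sum>l<n. B (k, l) *\<^sub>R v l) = (if k = i then \<sigma> else 0) *\<^sub>R v j"
        using ij by (simp add: B_def if_distrib[of "\<lambda>c. c *\<^sub>R _"] cong: if_cong)
      then show ?thesis
        unfolding P_def u_def by (simp only: mix_identity_perturbation[OF that]) simp
    qed
    then have mix: "sq_norm n (mix n (P s) v) = sq_norm n u"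
      by (intro tuple_norm_cong[OF tuple_norm_sq_norm])
    have "AE t in M. \<forall>k\<in>{..<n}. J (u k) t = J (v k) t + (if k = i then s * \<sigma> else 0) * J (v j) t"
      unfolding u_def using AE_J_add_scale by (intro AE_finite_allI) auto
    then have le: "AE t in M. sq_fun n u t powr q \<le> sq_fun n v t powr q +
        q * s * \<sigma> * moment n v i j t + \<kappa> * s\<^sup>2 * sq_fun n v t powr q"
    proof eventually_elim
      case (elim t)
      then have "sq_fun n u t =
          L2_set (\<lambda>k. J (v k) t + (if k = i then s * \<sigma> else 0) * J (v j) t) {..<n}"
        unfolding sq_fun_def by (intro L2_set_cong) auto
      then show ?case
        using L2_set_powr_perturb[of i n j \<sigma> q s "\<lambda>k. J (v k) t"] ij \<sigma> q s s'
        by (simp add: sq_fun_def moment_def \<kappa>_def)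
    qed
    have "sq_norm n u powr q \<le> (LINT t|M. sq_fun n v t powr q +
        q * s * \<sigma> * moment n v i j t + \<kappa> * s\<^sup>2 * sq_fun n v t powr q)"
      unfolding sq_norm_powr
      by (intro integral_mono_AE le integrable_sq_fun Bochner_Integration.integrable_add
          integrable_mult_right integrable_moment ij)
    also have "\<dots> = A + q * s * \<sigma> * m + \<kappa> * s\<^sup>2 * A"
      using integrable_sq_fun[of n v] integrable_moment[OF ij, of v]
      by (simp add: A_def m_def sq_norm_powr)
    finally have up: "sq_norm n u powr q \<le> A + q * s * \<sigma> * m + \<kappa> * s\<^sup>2 * A" .
    have "A * mdet n (P s) powr (q / n) = (mdet n (P s) * sq_norm n v ^ n) powr (q / n)"
      using pos n by (simp add: powr_mult A_def powr_powr flip: powr_realpow)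
    also have "\<dots> \<le> (sq_norm n u ^ n) powr (q / n)"
      using ext[of "P s"] det pos q by (intro powr_mono2) (auto simp: mix)
    also have "\<dots> = sq_norm n u powr q"
    proof (cases "sq_norm n u = 0")
      case False
      then have "sq_norm n u > 0"
        by (simp add: order_less_le)
      then show ?thesis
        using n by (simp add: powr_powr flip: powr_realpow)
    qed (use n in simp)
    finally have "A * mdet n (P s) powr (q / n) \<le> A + q * s * \<sigma> * m + \<kappa> * s\<^sup>2 * A"
      using up by linarith
    then have "A * g s \<ge> 0"
      using A by (simp add: g_def algebra_simps)
    then have "g s \<ge> 0"
      using A by (simp add: zero_le_mult_iff)
    moreover have "g 0 = 0"
      by (simp add: g_def P0)
    ultimately show False
      using d1(2)[of s] s by simp
  qed
  have "\<delta> / n = m / A"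
    using ge[of 1] ge[of "-1"] by simp
  then have "m = A * (\<delta> / n)"
    using A by simp
  then show ?thesis
    by (simp add: m_def A_def \<delta>_def)
qed

theorem lewis_basis:
  assumes dim: "dim V = n" and n: "n \<ge> 1"
  shows "\<exists>v. (\<forall>x\<in>V. \<exists>a. x = (\<Sum>i<n. a i *\<^sub>R v i)) \<and>
    (LINT t|M. sq_fun n v t powr q) = n \<and>
    (\<forall>i<n. \<forall>j<n. (LINT t|M. moment n v i j t) = (if i = j then 1 else 0))"
proof -
  obtain v where pos: "sq_norm n v > 0"
    and span: "\<And>x. x \<in> V \<Longrightarrow> \<exists>a. x = (\<Sum>i<n. a i *\<^sub>R v i)"
    and ext: "\<And>P. mdet n P * sq_norm n v ^ n \<le> sq_norm n (mix n P v) ^ n"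
    using extremal_basis[OF dim n tuple_norm_sq_norm] by blast
  define c where "c = n powr (1 / q) / sq_norm n v"
  have c: "c > 0"
    using pos n by (simp add: c_def)
  have hom: "sq_norm n (\<lambda>i. b *\<^sub>R u i) = \<bar>b\<bar> * sq_norm n u" for b and u :: "nat \<Rightarrow> 'a"
    using tuple_norm_sq_norm unfolding tuple_norm_def by blast
  define w where "w i = c *\<^sub>R v i" for i
  have sw: "sq_norm n w = n powr (1 / q)"
    unfolding w_def hom using pos c by (simp add: c_def)
  have extw: "mdet n P * sq_norm n w ^ n \<le> sq_norm n (mix n P w) ^ n" for P
  proof -
    have "mix n P w = (\<lambda>i. c *\<^sub>R mix n P v i)"
      by (simp add: mix_def w_def scaleR_sum_right fun_eq_iff mult.commute)
    then have "sq_norm n (mix n P w) ^ n = c ^ n * sq_norm n (mix n P v) ^ n"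
      using c by (simp add: hom power_mult_distrib)
    moreover have "sq_norm n w ^ n = c ^ n * sq_norm n v ^ n"
      unfolding w_def hom using c by (simp add: power_mult_distrib)
    ultimately show ?thesis
      using ext[of P] c by (simp add: mult.left_commute)
  qed
  have pw: "sq_norm n w > 0"
    using n by (simp add: sw)
  have nq: "sq_norm n w powr q = n"
    using q n by (simp add: sw powr_powr)
  show ?thesis
  proof (intro exI[of _ w] conjI ballI allI impI)
    fix x assume "x \<in> V"
    then obtain a where "x = (\<Sum>i<n. a i *\<^sub>R v i)"
      using span by blast
    then have "x = (\<Sum>i<n. (a i / c) *\<^sub>R w i)"
      using c by (simp add: w_def)
    then show "\<exists>a. x = (\<Sum>i<n. a i *\<^sub>R w i)"
      by (intro exI[of _ "\<lambda>i. a i / c"])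
  next
    show "(LINT t|M. sq_fun n w t powr q) = n"
      using nq by (simp add: sq_norm_powr)
  next
    fix i j assume "i < n" "j < n"
    then show "(LINT t|M. moment n w i j t) = (if i = j then 1 else 0)"
      using moment_eq_if_extremal[OF extw pw n] n by (simp add: nq)
  qed
qed


lemma integral_comb_power2:
  assumes orth: "\<And>i j. i < n \<Longrightarrow> j < n \<Longrightarrow>
      (LINT t|M. moment n v i j t) = (if i = j then 1 else 0)"
    and x: "AE t in M. J x t = (\<Sum>i<n. a i * J (v i) t)"
  shows "integrable M (\<lambda>t. (J x t)\<^sup>2 * sq_fun n v t powr (q - 2))" (is "integrable M ?w")
    and "(LINT t|M. (J x t)\<^sup>2 * sq_fun n v t powr (q - 2)) = (L2_set a {..<n})\<^sup>2"
proof -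
  define W where "W t = (\<Sum>i<n. \<Sum>j<n. a i * a j * moment n v i j t)" for t
  have W: "integrable M W"
    unfolding W_def by (intro Bochner_Integration.integrable_sum integrable_mult_right integrable_moment) auto
  have ae: "AE t in M. W t = ?w t"
    using x
  proof eventually_elim
    case (elim t)
    have "(\<Sum>i<n. a i * J (v i) t)\<^sup>2 = (\<Sum>i<n. \<Sum>j<n. (a i * J (v i) t) * (a j * J (v j) t))"
      by (simp only: power2_eq_square sum_product)
    then show ?case
      unfolding W_def elim by (simp only: sum_distrib_right moment_def) (simp only: mult_ac)
  qed
  have [measurable]: "W \<in> borel_measurable M"
    using W by simp
  show "integrable M ?w"
    by (rule integrable_cong_AE_imp[OF W _ ae]) measurable
  have "(LINT t|M. ?w t) = (LINT t|M. W t)"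
    by (rule integral_cong_AE) (use ae in \<open>auto simp: eq_commute\<close>)
  also have "\<dots> = (\<Sum>i<n. \<Sum>j<n. a i * a j * (LINT t|M. moment n v i j t))"
  proof -
    have "(LINT t|M. W t) = (\<Sum>i<n. LINT t|M. (\<Sum>j<n. a i * a j * moment n v i j t))"
      unfolding W_def
      by (intro Bochner_Integration.integral_sum Bochner_Integration.integrable_sum
          integrable_mult_right integrable_moment) auto
    also have "\<dots> = (\<Sum>i<n. \<Sum>j<n. LINT t|M. a i * a j * moment n v i j t)"
      by (intro sum.cong refl Bochner_Integration.integral_sum integrable_mult_right
          integrable_moment) auto
    finally show ?thesis
      by simp
  qed
  also have "\<dots> = (\<Sum>i<n. a i * a i)"
    by (intro sum.cong refl) (simp add: orth if_distrib[of "\<lambda>c. _ * c"] cong: if_cong)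
  finally show "(LINT t|M. ?w t) = (L2_set a {..<n})\<^sup>2"
    by (simp only: L2_set_power2) (simp only: power2_eq_square)
qed

text \<open>
  Write \<open>f = \<Sum>\<^sub>i a\<^sub>i v\<^sub>i\<close>. Orthonormality says \<open>|a|\<^sup>2 = \<integral>f\<^sup>2 F\<^bsup>q-2\<^esup>\<close>, and \<open>|f| \<le> |a| F\<close> pointwise by
  Cauchy--Schwarz. The bounds with constant \<open>1\<close> follow by replacing a power of \<open>|f|\<close> by the same
  power of \<open>|a| F\<close>; those with a power of \<open>n = \<integral>F\<^sup>q\<close> are Hoelder's inequality, with exponent
  \<open>\<theta> = 2/q\<close> or \<open>\<theta> = q/2\<close>.
\<close>

lemma norm_L2_comparison:
  assumes n: "n \<ge> 1"
    and one: "(LINT t|M. sq_fun n v t powr q) = n"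
    and orth: "\<And>i j. i < n \<Longrightarrow> j < n \<Longrightarrow>
      (LINT t|M. moment n v i j t) = (if i = j then 1 else 0)"
  defines "x \<equiv> (\<lambda>a. \<Sum>i<n. a i *\<^sub>R v i)"
  shows "q \<ge> 2 \<Longrightarrow> norm (x a) \<le> L2_set a {..<n}"
    and "q \<ge> 2 \<Longrightarrow> L2_set a {..<n} \<le> n powr (1 / 2 - 1 / q) * norm (x a)"
    and "q \<le> 2 \<Longrightarrow> L2_set a {..<n} \<le> norm (x a)"
    and "q \<le> 2 \<Longrightarrow> norm (x a) \<le> n powr (1 / q - 1 / 2) * L2_set a {..<n}"
proof -
  define b where "b = L2_set a {..<n}"
  define f F where "f = J (x a)" and "F = sq_fun n v"
  have [measurable]: "f \<in> borel_measurable M" "F \<in> borel_measurable M"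
    by (simp_all add: f_def F_def)
  have F0: "0 \<le> F t" for t
    by (simp add: F_def)
  have AEx: "AE t in M. J (x a) t = (\<Sum>i<n. a i * J (v i) t)"
    unfolding x_def by (rule AE_J_sum) simp
  have f_le: "AE t in M. \<bar>f t\<bar> \<le> b * F t"
    using AEx
  proof eventually_elim
    case (elim t)
    have "\<bar>f t\<bar> \<le> (\<Sum>i<n. \<bar>a i\<bar> * \<bar>J (v i) t\<bar>)"
      unfolding f_def elim by (rule order_trans[OF sum_abs]) (simp add: abs_mult)
    also have "\<dots> \<le> b * F t"
      unfolding b_def F_def sq_fun_def by (rule L2_set_mult_ineq)
    finally show ?case .
  qed
  define w where "w t = (f t)\<^sup>2 * F t powr (q - 2)" for t
  have w0: "0 \<le> w t" for t
    by (simp add: w_def)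
  have intw: "integrable M w" and w: "(LINT t|M. w t) = b\<^sup>2"
    using integral_comb_power2[OF orth AEx] by (simp_all add: w_def[abs_def] f_def F_def b_def)
  have intF: "integrable M (\<lambda>t. F t powr q)" and F: "(LINT t|M. F t powr q) = n"
    using integrable_sq_fun one by (simp_all add: F_def)
  have intf: "integrable M (\<lambda>t. \<bar>f t\<bar> powr q)" and f: "(LINT t|M. \<bar>f t\<bar> powr q) = norm (x a) powr q"
    using integrable_J norm_powr by (simp_all add: f_def)
  have b0: "0 \<le> b"
    by (simp add: b_def)
  have x0: "x a = 0" if "b = 0"
    using that by (simp add: b_def x_def L2_set_eq_0_iff)
  have b_pos: "norm (x a) > 0" if "b > 0"
  proof (rule ccontr)
    assume "\<not> ?thesis"
    then have "(LINT t|M. \<bar>f t\<bar> powr q) = 0"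
      by (simp add: f)
    then have "AE t in M. \<bar>f t\<bar> powr q = 0"
      using integral_nonneg_eq_0_iff_AE[OF intf] by simp
    then have "AE t in M. w t = 0"
      by eventually_elim (simp add: w_def)
    then have "(LINT t|M. w t) = 0"
      by (rule integral_eq_zero_AE)
    then show False
      using w that by simp
  qed
  have powr_le: "y \<le> z" if "y powr q \<le> z powr q" "0 \<le> y" "0 \<le> z" for y z :: real
    using that q powr_less_mono2[of q z y] by force
  show "norm (x a) \<le> L2_set a {..<n}" if q2: "q \<ge> 2"
  proof (cases "b = 0")
    case False
    have ae: "AE t in M. \<bar>f t\<bar> powr q \<le> b powr (q - 2) * w t"
      using f_le
    proof eventually_elim
      case (elim t)
      have "\<bar>f t\<bar> powr q = \<bar>f t\<bar> powr (q - 2) * (f t)\<^sup>2"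
        using powr_minus_two_mult_power2[of "\<bar>f t\<bar>" q] by simp
      also have "\<dots> \<le> (b * F t) powr (q - 2) * (f t)\<^sup>2"
        using elim q2 by (intro mult_right_mono powr_mono2) auto
      finally show ?case
        by (simp add: w_def powr_mult mult_ac)
    qed
    have "norm (x a) powr q \<le> (LINT t|M. b powr (q - 2) * w t)"
      unfolding f[symmetric] by (intro integral_mono_AE ae intf integrable_mult_right intw)
    also have "\<dots> = b powr q"
      using powr_minus_two_mult_power2[OF b0, of q] by (simp add: w)
    finally show ?thesis
      unfolding b_def[symmetric] by (rule powr_le) (use b0 in simp_all)
  qed (use x0 b0 in \<open>simp add: b_def\<close>)
  show "L2_set a {..<n} \<le> n powr (1 / 2 - 1 / q) * norm (x a)" if q2: "q \<ge> 2"
  proof (cases "b = 0")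
    case False
    then have b: "b > 0"
      using b0 by simp
    have eq: "w t = (\<bar>f t\<bar> powr q) powr (2 / q) * (F t powr q) powr (1 - 2 / q)" if "\<bar>f t\<bar> \<le> b * F t" for t
    proof (cases "f t = 0")
      case False
      have "q * (1 - 2 / q) = q - 2"
        using q2 by (simp add: right_diff_distrib)
      then show ?thesis
        using q2 False by (simp add: w_def powr_powr)
    qed (simp add: w_def)
    have "b\<^sup>2 = (LINT t|M. (\<bar>f t\<bar> powr q) powr (2 / q) * (F t powr q) powr (1 - 2 / q))"
    proof (subst w[symmetric], rule integral_cong_AE)
      show "AE t in M. w t = (\<bar>f t\<bar> powr q) powr (2 / q) * (F t powr q) powr (1 - 2 / q)"
        using f_le by eventually_elim (rule eq)
    qed (use intw in auto)
    also have "\<dots> \<le> (norm (x a) powr q) powr (2 / q) * n powr (1 - 2 / q)"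
      unfolding f[symmetric] F[symmetric] using q2 b_pos[OF b] n
      by (intro integral_powr_mult_powr_le intf intF) (auto simp: f F)
    also have "\<dots> = (n powr (1 / 2 - 1 / q) * norm (x a))\<^sup>2"
    proof -
      have "(n powr (1 / 2 - 1 / q))\<^sup>2 = n powr (1 - 2 / q)"
        by (simp add: power2_eq_square flip: powr_add)
      then show ?thesis
        using q2 b_pos[OF b] by (simp add: powr_powr power_mult_distrib)
    qed
    finally have "b \<le> n powr (1 / 2 - 1 / q) * norm (x a)"
      by (rule power2_le_imp_le) simp
    then show ?thesis
      by (simp add: b_def)
  qed (simp add: b_def)
  show "L2_set a {..<n} \<le> norm (x a)" if q2: "q \<le> 2"
  proof (cases "b = 0")
    case False
    then have b: "b > 0"
      using b0 by simp
    have ae: "AE t in M. w t \<le> b powr (2 - q) * \<bar>f t\<bar> powr q"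
      using f_le
    proof eventually_elim
      case (elim t)
      show ?case
      proof (cases "f t = 0")
        case False
        then have Ft: "F t > 0"
          using elim F0[of t] by (cases "F t = 0") auto
        have "w t = \<bar>f t\<bar> powr q * (\<bar>f t\<bar> powr (2 - q) * F t powr (q - 2))"
          using False by (simp add: w_def flip: powr_add mult.assoc)
        also have "\<dots> \<le> \<bar>f t\<bar> powr q * ((b * F t) powr (2 - q) * F t powr (q - 2))"
          using elim q2 by (intro mult_left_mono mult_right_mono powr_mono2) auto
        also have "\<dots> = b powr (2 - q) * \<bar>f t\<bar> powr q"
          using Ft by (simp add: powr_mult mult_ac flip: powr_add)
        finally show ?thesis .
      qed (simp add: w_def)
    qed
    have "b\<^sup>2 \<le> (LINT t|M. b powr (2 - q) * \<bar>f t\<bar> powr q)"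
      unfolding w[symmetric] by (intro integral_mono_AE ae intf integrable_mult_right intw)
    also have "\<dots> = b powr (2 - q) * norm (x a) powr q"
      by (simp add: f)
    finally have "b powr (2 - q) * b powr q \<le> b powr (2 - q) * norm (x a) powr q"
      using b by (simp flip: powr_add)
    then have "b powr q \<le> norm (x a) powr q"
      using b by simp
    then show ?thesis
      unfolding b_def[symmetric] by (rule powr_le) (use b0 in simp_all)
  qed (simp add: b_def)
  show "norm (x a) \<le> n powr (1 / q - 1 / 2) * L2_set a {..<n}" if q2: "q \<le> 2"
  proof (cases "b = 0")
    case False
    then have b: "b > 0"
      using b0 by simp
    have eq: "\<bar>f t\<bar> powr q = w t powr (q / 2) * (F t powr q) powr (1 - q / 2)" if "\<bar>f t\<bar> \<le> b * F t" for t
    proof (cases "f t = 0")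
      case False
      then have Ft: "F t > 0"
        using that F0[of t] by (cases "F t = 0") auto
      have "w t powr (q / 2) = \<bar>f t\<bar> powr q * F t powr ((q - 2) * (q / 2))"
        using powr_powr[of "\<bar>f t\<bar>" 2 "q / 2"] False by (simp add: w_def powr_mult powr_powr)
      moreover have "(q - 2) * (q / 2) + q * (1 - q / 2) = 0"
        by (simp add: field_simps)
      ultimately show ?thesis
        using Ft by (simp add: powr_powr mult.assoc flip: powr_add)
    qed (simp add: w_def)
    have "norm (x a) powr q = (LINT t|M. w t powr (q / 2) * (F t powr q) powr (1 - q / 2))"
    proof (subst f[symmetric], rule integral_cong_AE)
      show "AE t in M. \<bar>f t\<bar> powr q = w t powr (q / 2) * (F t powr q) powr (1 - q / 2)"
        using f_le by eventually_elim (rule eq)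
    qed (use intw in auto)
    also have "\<dots> \<le> (b\<^sup>2) powr (q / 2) * n powr (1 - q / 2)"
      unfolding w[symmetric] F[symmetric] using q q2 b n w0
      by (intro integral_powr_mult_powr_le intw intF) (auto simp: w F)
    also have "\<dots> = (n powr (1 / q - 1 / 2) * b) powr q"
    proof -
      have "(1 / q - 1 / 2) * q = 1 - q / 2"
        using q by (simp add: left_diff_distrib)
      moreover have "(b\<^sup>2) powr (q / 2) = b powr q"
        using powr_powr[of b 2 "q / 2"] b by simp
      ultimately show ?thesis
        by (simp add: powr_mult powr_powr)
    qed
    finally show ?thesis
      unfolding b_def[symmetric] by (rule powr_le) (use b0 in simp_all)
  qed (use x0 in \<open>simp add: b_def\<close>)
qed

theorem lewis_euclidean_frame:
  fixes V :: "'a set"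
  assumes dim: "dim V = n" and n: "n \<ge> 1"
  shows "\<exists>v. euclidean_frame n (n powr \<bar>1 / 2 - 1 / q\<bar>) V v"
proof -
  obtain v where span: "\<And>x. x \<in> V \<Longrightarrow> \<exists>a. x = (\<Sum>i<n. a i *\<^sub>R v i)"
    and one: "(LINT t|M. sq_fun n v t powr q) = n"
    and orth: "\<And>i j. i < n \<Longrightarrow> j < n \<Longrightarrow>
      (LINT t|M. moment n v i j t) = (if i = j then 1 else 0)"
    using lewis_basis[OF dim n] by blast
  have cmp1: "q \<ge> 2 \<Longrightarrow> norm (\<Sum>i<n. a i *\<^sub>R v i) \<le> L2_set a {..<n}"
    and cmp2: "q \<ge> 2 \<Longrightarrow> L2_set a {..<n} \<le> n powr (1 / 2 - 1 / q) * norm (\<Sum>i<n. a i *\<^sub>R v i)"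
    and cmp3: "q \<le> 2 \<Longrightarrow> L2_set a {..<n} \<le> norm (\<Sum>i<n. a i *\<^sub>R v i)"
    and cmp4: "q \<le> 2 \<Longrightarrow> norm (\<Sum>i<n. a i *\<^sub>R v i) \<le> n powr (1 / q - 1 / 2) * L2_set a {..<n}" for a
    using norm_L2_comparison[OF n one] orth by blast+
  show ?thesis
  proof (cases "q \<ge> 2")
    case True
    then have "1 / q \<le> 1 / 2"
      by (intro divide_left_mono) auto
    then have e: "\<bar>1 / 2 - 1 / q\<bar> = 1 / 2 - 1 / q"
      by simp
    show ?thesis
      unfolding e euclidean_frame_def
      using cmp1[OF True] cmp2[OF True] span by (intro exI[of _ v]) fastforce
  next
    case False
    then have q2: "q \<le> 2"
      by simp
    \<comment> \<open>For \<open>q < 2\<close> the map \<open>a \<mapsto> \<Sum>\<^sub>i a\<^sub>i v\<^sub>i\<close> expands lengths by a factor up to \<open>D\<close>; dividing by \<open>D\<close> makes it a contraction.\<close>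
    define D where "D = n powr \<bar>1 / 2 - 1 / q\<bar>"
    have D: "D > 0"
      using n by (simp add: D_def)
    have "1 / 2 \<le> 1 / q"
      using q q2 by (intro divide_left_mono) auto
    then have e: "D = n powr (1 / q - 1 / 2)"
      by (simp add: D_def)
    have "euclidean_frame n D V (\<lambda>i. (1 / D) *\<^sub>R v i)"
      unfolding euclidean_frame_def
    proof (intro conjI allI ballI)
      fix a
      have "(\<Sum>i<n. a i *\<^sub>R (1 / D) *\<^sub>R v i) = (1 / D) *\<^sub>R (\<Sum>i<n. a i *\<^sub>R v i)"
        by (simp add: scaleR_sum_right mult.commute)
      then show "norm (\<Sum>i<n. a i *\<^sub>R (1 / D) *\<^sub>R v i) \<le> L2_set a {..<n}"
        using cmp4[OF q2, of a] D by (simp add: e[symmetric] divide_le_eq mult.commute)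
    next
      fix x assume "x \<in> V"
      then obtain a where a: "x = (\<Sum>i<n. a i *\<^sub>R v i)"
        using span by blast
      have "(\<Sum>i<n. (D * a i) *\<^sub>R (1 / D) *\<^sub>R v i) = x"
        using D by (simp add: a)
      moreover have "L2_set (\<lambda>i. D * a i) {..<n} \<le> D * norm x"
        unfolding L2_set_scale using cmp3[OF q2, of a] D by (simp add: a)
      ultimately show "\<exists>a. (\<Sum>i<n. a i *\<^sub>R (1 / D) *\<^sub>R v i) = x \<and> L2_set a {..<n} \<le> D * norm x"
        by (intro exI[of _ "\<lambda>i. D * a i"]) blast
    qed
    then show ?thesis
      unfolding D_def by blast
  qed
qed

end

section \<open>Gluing Lipschitz maps\<close>

text \<open>
  Inserting \<open>0\<close> gives the maximum norm the right value when \<open>I\<close> is empty.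
\<close>

definition linf :: "nat set \<Rightarrow> (nat \<Rightarrow> real) \<Rightarrow> real" where
  "linf I y = Max (insert 0 ((\<lambda>i. \<bar>y i\<bar>) ` I))"

lemma linf_le_iff: "finite I \<Longrightarrow> linf I y \<le> c \<longleftrightarrow> 0 \<le> c \<and> (\<forall>i\<in>I. \<bar>y i\<bar> \<le> c)"
  by (simp add: linf_def)

lemma abs_le_linf: "finite I \<Longrightarrow> i \<in> I \<Longrightarrow> \<bar>y i\<bar> \<le> linf I y"
  by (simp add: linf_def)

lemma linf_nonneg: "finite I \<Longrightarrow> 0 \<le> linf I y"
  by (simp add: linf_def)

lemma linf_cong: "(\<And>i. i \<in> I \<Longrightarrow> y i = z i) \<Longrightarrow> linf I y = linf I z"
  by (simp add: linf_def cong: image_cong_simp)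

lemma linf_triangle:
  "finite I \<Longrightarrow> linf I (\<lambda>i. y i + z i) \<le> linf I y + linf I z"
  by (auto simp: linf_le_iff linf_nonneg intro!: order_trans[OF abs_triangle_ineq] add_mono abs_le_linf)

lemma linf_scale:
  assumes "finite I"
  shows "linf I (\<lambda>i. c * y i) = \<bar>c\<bar> * linf I y"
proof -
  have le: "linf I (\<lambda>i. b * z i) \<le> \<bar>b\<bar> * linf I z" for b z
    using assms by (auto simp: linf_le_iff linf_nonneg abs_mult intro!: mult_left_mono abs_le_linf)
  show ?thesis
  proof (cases "c = 0")
    case True
    then show ?thesis
      using le[of 0 y] linf_nonneg[OF assms, of "\<lambda>i. 0 * y i"] by simp
  next
    case False
    have "linf I (\<lambda>i. (1 / c) * (c * y i)) \<le> \<bar>1 / c\<bar> * linf I (\<lambda>i. c * y i)"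
      by (rule le)
    then have "\<bar>c\<bar> * linf I y \<le> linf I (\<lambda>i. c * y i)"
      using False by (simp add: field_simps)
    then show ?thesis
      using le[of c y] by simp
  qed
qed

lemma linf_minus: "finite I \<Longrightarrow> linf I (\<lambda>i. y i - z i) = linf I (\<lambda>i. z i - y i)"
  using linf_scale[of I "-1" "\<lambda>i. z i - y i"] by simp

lemma linf_diff_triangle:
  assumes "finite I"
  shows "linf I (\<lambda>i. x i - z i) \<le> linf I (\<lambda>i. x i - y i) + linf I (\<lambda>i. y i - z i)"
  using linf_triangle[OF assms, of "\<lambda>i. x i - y i" "\<lambda>i. y i - z i"] by simp

text \<open>
  The unit ball is the product of the Euclidean ball in the first \<open>n\<close> coordinates, which
  parametrize a subspace, and the cube in the last \<open>m\<close>, which select it.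
\<close>

definition cylinder_norm :: "nat \<Rightarrow> nat \<Rightarrow> (nat \<Rightarrow> real) \<Rightarrow> real" where
  "cylinder_norm n m y = max (L2_set y {..<n}) (linf {n..<n + m} y)"

lemma norm_on_Rk_cylinder_norm: "norm_on_Rk (n + m) (cylinder_norm n m)"
  unfolding norm_on_Rk_def
proof (intro conjI ballI allI)
  fix y assume y: "y \<in> Rk (n + m)"
  show "0 \<le> cylinder_norm n m y"
    by (simp add: cylinder_norm_def le_max_iff_disj)
  show "cylinder_norm n m y = 0 \<longleftrightarrow> y = (\<lambda>i. 0)"
  proof
    assume "cylinder_norm n m y = 0"
    then have "L2_set y {..<n} \<le> 0" "linf {n..<n + m} y \<le> 0"
      by (simp_all add: cylinder_norm_def)
    then have "\<forall>i<n. y i = 0" "\<forall>i\<in>{n..<n + m}. y i = 0"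
      using L2_set_eq_0_iff[of "{..<n}" y] L2_set_nonneg[of y "{..<n}"] by (auto simp: linf_le_iff)
    then show "y = (\<lambda>i. 0)"
      using y unfolding Rk_def fun_eq_iff by (metis (mono_tags) atLeastLessThan_iff leI mem_Collect_eq)
  next
    assume "y = (\<lambda>i. 0)"
    moreover have "linf {n..<n + m} (\<lambda>i. 0) = 0"
      using linf_scale[of "{n..<n + m}" 0 "\<lambda>i. 0"] by simp
    ultimately show "cylinder_norm n m y = 0"
      by (simp add: cylinder_norm_def L2_set_def)
  qed
  fix c
  show "cylinder_norm n m (\<lambda>i. c * y i) = \<bar>c\<bar> * cylinder_norm n m y"
    by (simp add: cylinder_norm_def L2_set_scale linf_scale max_mult_distrib_left)
next
  fix y z :: "nat \<Rightarrow> real"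
  show "cylinder_norm n m (\<lambda>i. y i + z i) \<le> cylinder_norm n m y + cylinder_norm n m z"
    unfolding cylinder_norm_def
    using L2_set_triangle_ineq[of y z "{..<n}"] linf_triangle[of "{n..<n + m}" y z] by auto
qed

definition hat :: "nat set \<Rightarrow> real \<Rightarrow> (nat \<Rightarrow> real) \<Rightarrow> (nat \<Rightarrow> real) \<Rightarrow> real" where
  "hat I s \<tau> y = max 0 (1 - s * linf I (\<lambda>i. y i - \<tau> i))"

lemma hat_nonneg: "0 \<le> hat I s \<tau> y"
  by (simp add: hat_def)

lemma hat_lipschitz:
  assumes "finite I" "0 \<le> s"
  shows "\<bar>hat I s \<tau> y - hat I s \<tau> y'\<bar> \<le> s * linf I (\<lambda>i. y i - y' i)"
proof -
  have "s * linf I (\<lambda>i. x i - \<tau> i) \<le> s * linf I (\<lambda>i. x i - x' i) + s * linf I (\<lambda>i. x' i - \<tau> i)" for x x'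
    using linf_diff_triangle[OF assms(1), of x \<tau> x'] assms(2)
    by (simp add: mult_left_mono flip: distrib_left)
  from this[of y y'] this[of y' y] show ?thesis
    using assms linf_minus[OF assms(1), of y y'] linf_nonneg[OF assms(1), of "\<lambda>i. y i - y' i"]
    by (auto simp: hat_def max_def)
qed

text \<open>
  If both hats are positive at the respective points, then
  \<open>h(y) + h'(y') = 2 - s(|y - \<tau>| + |y' - \<tau>'|)\<close>, and by the triangle inequality the sum of the two
  distances is at least \<open>2/s - |y - y'|\<close>.
\<close>

lemma hats_disjoint:
  assumes I: "finite I" and s: "0 \<le> s" and sep: "2 \<le> s * linf I (\<lambda>i. \<tau> i - \<tau>' i)"
  shows "hat I s \<tau> y + hat I s \<tau>' y' \<le> s * linf I (\<lambda>i. y i - y' i) \<or> hat I s \<tau> y = 0 \<or> hat I s \<tau>' y' = 0"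
proof (rule ccontr)
  assume neg: "\<not> ?thesis"
  have "linf I (\<lambda>i. \<tau> i - \<tau>' i) \<le>
      linf I (\<lambda>i. y i - \<tau> i) + (linf I (\<lambda>i. y i - y' i) + linf I (\<lambda>i. y' i - \<tau>' i))"
    using linf_diff_triangle[OF I, of \<tau> \<tau>' y] linf_diff_triangle[OF I, of y \<tau>' y']
      linf_minus[OF I, of \<tau> y] by simp
  then have "s * linf I (\<lambda>i. \<tau> i - \<tau>' i) \<le>
      s * (linf I (\<lambda>i. y i - \<tau> i) + (linf I (\<lambda>i. y i - y' i) + linf I (\<lambda>i. y' i - \<tau>' i)))"
    using s by (rule mult_left_mono)
  with sep neg show False
    by (auto simp: hat_def max_def distrib_left split: if_splits)
qed

lemma hats_disjoint_at_point:
  assumes "finite I" "0 \<le> s" "2 \<le> s * linf I (\<lambda>i. \<tau> i - \<tau>' i)"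
  shows "hat I s \<tau> y = 0 \<or> hat I s \<tau>' y = 0"
proof -
  have "linf I (\<lambda>i. y i - y i) = 0"
    using linf_scale[OF assms(1), of 0 y] by simp
  then show ?thesis
    using hats_disjoint[OF assms, of y y] hat_nonneg[of I s \<tau> y] hat_nonneg[of I s \<tau>' y] by auto
qed

text \<open>
  At each point at most one hat is positive. Hence at most two summands of the variation are nonzero:
  if there is only one, the slope of that hat bounds it, and if \<open>y\<close> and \<open>y'\<close> lie under
  different hats, the two heights are bounded together.
\<close>

lemma hats_variation:
  assumes L: "finite L" and I: "finite I" and s: "0 \<le> s"
    and sep: "\<And>V W. V \<in> L \<Longrightarrow> W \<in> L \<Longrightarrow> V \<noteq> W \<Longrightarrow> 2 \<le> s * linf I (\<lambda>i. \<tau> V i - \<tau> W i)"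
  shows "(\<Sum>V\<in>L. hat I s (\<tau> V) y) \<le> 1"
    and "(\<Sum>V\<in>L. \<bar>hat I s (\<tau> V) y - hat I s (\<tau> V) y'\<bar>) \<le> s * linf I (\<lambda>i. y i - y' i)"
proof -
  define h where "h V = hat I s (\<tau> V)" for V
  define d where "d = s * linf I (\<lambda>i. y i - y' i)"
  have d: "0 \<le> d"
    using s linf_nonneg[OF I] by (simp add: d_def)
  have lip: "\<bar>h V y - h V y'\<bar> \<le> d" for V
    unfolding h_def d_def by (rule hat_lipschitz[OF I s])
  have active: "\<exists>V0. \<forall>V\<in>L. V \<noteq> V0 \<longrightarrow> h V x = 0" for x
  proof (cases "\<exists>V0\<in>L. h V0 x \<noteq> 0")
    case True
    then show ?thesis
      unfolding h_def using hats_disjoint_at_point[OF I s sep] by blast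
  qed blast
  obtain V0 where V0: "\<And>V. V \<in> L \<Longrightarrow> V \<noteq> V0 \<Longrightarrow> h V y = 0"
    using active[of y] by blast
  obtain V1 where V1: "\<And>V. V \<in> L \<Longrightarrow> V \<noteq> V1 \<Longrightarrow> h V y' = 0"
    using active[of y'] by blast
  have "(\<Sum>V\<in>L. h V y) = (\<Sum>V\<in>L \<inter> {V0}. h V y)"
    using L V0 by (intro sum.mono_neutral_right) auto
  also have "\<dots> \<le> 1"
    using s linf_nonneg[OF I] by (cases "V0 \<in> L") (auto simp: h_def hat_def)
  finally show "(\<Sum>V\<in>L. hat I s (\<tau> V) y) \<le> 1"
    by (simp add: h_def)
  have "(\<Sum>V\<in>L. \<bar>h V y - h V y'\<bar>) = (\<Sum>V\<in>L \<inter> {V0, V1}. \<bar>h V y - h V y'\<bar>)"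
    using L V0 V1 by (intro sum.mono_neutral_right) auto
  also have "\<dots> \<le> d"
  proof (cases "V0 \<in> L \<and> V1 \<in> L \<and> V0 \<noteq> V1")
    case True
    then have "L \<inter> {V0, V1} = {V0, V1}"
      by auto
    moreover have "h V0 y' = 0" "h V1 y = 0"
      using True V0 V1 by auto
    moreover have "h V0 y + h V1 y' \<le> d \<or> h V0 y = 0 \<or> h V1 y' = 0"
      unfolding h_def d_def using True by (intro hats_disjoint I s sep) auto
    moreover have "0 \<le> h V0 y" "0 \<le> h V1 y'"
      by (simp_all add: h_def hat_nonneg)
    ultimately show ?thesis
      using True lip[of V0] lip[of V1] by auto
  next
    case False
    then have "L \<inter> {V0, V1} = {} \<or> (\<exists>V. L \<inter> {V0, V1} = {V})"
      by auto
    then show ?thesis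
      using d lip by auto
  qed
  finally show "(\<Sum>V\<in>L. \<bar>hat I s (\<tau> V) y - hat I s (\<tau> V) y'\<bar>) \<le> s * linf I (\<lambda>i. y i - y' i)"
    by (simp add: h_def d_def)
qed

text \<open>
  Approximants of norm at most \<open>2\<close> suffice: either \<open>0\<close> is good enough, or every good approximant is
  at distance less than \<open>\<parallel>f\<parallel> \<le> 1\<close> from \<open>f\<close>.
\<close>

lemma near_best_approximation:
  fixes f :: "'a::real_normed_vector"
  assumes "0 \<in> V" "norm f \<le> 1" "e > 0"
  shows "\<exists>x\<in>V. norm x \<le> 2 \<and> norm (f - x) < infdist f V + e"
proof (cases "norm f < infdist f V + e")
  case True
  then show ?thesis
    using assms(1) by (intro bexI[of _ 0]) auto
next
  case False
  have "V \<noteq> {}"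
    using assms(1) by blast
  then have "(INF x\<in>V. dist f x) < infdist f V + e"
    using assms(3) by (simp add: infdist_notempty)
  then obtain x where x: "x \<in> V" "dist f x < infdist f V + e"
    using \<open>V \<noteq> {}\<close> by (subst (asm) cINF_less_iff) (auto intro: bdd_belowI2[of _ 0])
  have "norm x \<le> norm f + norm (f - x)"
    by (metis norm_minus_commute norm_triangle_sub)
  then have "norm x \<le> 2"
    using x(2) False assms(2) by (simp add: dist_norm)
  with x show ?thesis
    by (auto simp: dist_norm)
qed

text \<open>
  The glued map is \<open>\<Phi>(y, t) = \<Sum>\<^sub>V h\<^sub>V(t) 2D T\<^sub>V y\<close>. Moving \<open>y\<close> costs at most \<open>2D\<close>, as the hats sum
  to at most \<open>1\<close>; moving \<open>t\<close> costs at most \<open>2D s\<close>, by the total variation of the hats and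
  \<open>\<parallel>2D T\<^sub>V y\<parallel> \<le> 2D\<close>. At \<open>t = \<tau> V\<close> only the hat of \<open>V\<close> is alive, and \<open>\<Phi>\<close> reaches all
  elements of \<open>V\<close> of norm at most \<open>2\<close>.
\<close>

lemma lipschitz_width_le_glued:
  fixes K :: "'a::real_normed_vector set" and L :: "'a set set" and \<tau> :: "'a set \<Rightarrow> nat \<Rightarrow> real"
  assumes n: "n \<ge> 1" and L: "finite L" and D: "D > 0" and s: "0 \<le> s"
    and frames: "\<And>V. V \<in> L \<Longrightarrow> \<exists>v. euclidean_frame n D V v"
    and zero: "\<And>V. V \<in> L \<Longrightarrow> 0 \<in> V"
    and K: "\<And>f. f \<in> K \<Longrightarrow> norm f \<le> 1"
    and \<tau>: "\<And>V i. V \<in> L \<Longrightarrow> \<bar>\<tau> V i\<bar> \<le> 1"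
    and sep: "\<And>V W. V \<in> L \<Longrightarrow> W \<in> L \<Longrightarrow> V \<noteq> W \<Longrightarrow>
      2 \<le> s * linf {n..<n + m} (\<lambda>i. \<tau> V i - \<tau> W i)"
    and \<gamma>: "2 * D * (1 + s) \<le> \<gamma>"
  shows "lipschitz_width \<gamma> (n + m) K \<le> (SUP f\<in>K. INF V\<in>L. ennreal (infdist f V))"
proof -
  define I where "I = {n..<n + m}"
  have I: "finite I"
    by (simp add: I_def)
  note sep' = sep[folded I_def]
  define \<nu> where "\<nu> = cylinder_norm n m"
  obtain v where v: "\<And>V. V \<in> L \<Longrightarrow> euclidean_frame n D V (v V)"
    using frames by metis
  define T where "T V y = (2 * D) *\<^sub>R (\<Sum>i<n. y i *\<^sub>R v V i)" for V and y :: "nat \<Rightarrow> real"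
  have T: "norm (T V y) \<le> 2 * D * L2_set y {..<n}" if "V \<in> L" for V y
    using v[OF that] D by (simp add: T_def euclidean_frame_def)
  have T_diff: "T V y - T V y' = T V (\<lambda>i. y i - y' i)" for V y y'
    by (simp add: T_def scaleR_diff_left sum_subtractf flip: scaleR_diff_right)
  define h where "h V = hat I s (\<tau> V)" for V
  have h0: "0 \<le> h V y" for V y
    by (simp add: h_def hat_nonneg)
  define \<Phi> where "\<Phi> y = (\<Sum>V\<in>L. h V y *\<^sub>R T V y)" for y
  have "\<Phi> \<in> lipschitz_maps \<gamma> (n + m) \<nu>"
    unfolding lipschitz_maps_def
  proof (intro CollectI ballI)
    fix y y' assume "y \<in> unit_ball_Rk (n + m) \<nu>" and y': "y' \<in> unit_ball_Rk (n + m) \<nu>"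
    define \<rho> where "\<rho> = \<nu> (\<lambda>i. y i - y' i)"
    have \<rho>: "L2_set (\<lambda>i. y i - y' i) {..<n} \<le> \<rho>" "linf I (\<lambda>i. y i - y' i) \<le> \<rho>"
      by (auto simp: \<rho>_def \<nu>_def cylinder_norm_def I_def)
    have \<rho>0: "0 \<le> \<rho>"
      using \<rho>(1) L2_set_nonneg order_trans by blast
    have y'1: "L2_set y' {..<n} \<le> 1"
      using y' by (auto simp: unit_ball_Rk_def \<nu>_def cylinder_norm_def)
    have diff: "\<Phi> y - \<Phi> y' = (\<Sum>V\<in>L. h V y *\<^sub>R T V (\<lambda>i. y i - y' i) + (h V y - h V y') *\<^sub>R T V y')"
      unfolding \<Phi>_def T_diff[symmetric] by (simp add: algebra_simps flip: sum_subtractf)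
    have "norm (\<Phi> y - \<Phi> y') \<le> (\<Sum>V\<in>L. h V y * (2 * D * \<rho>) + \<bar>h V y - h V y'\<bar> * (2 * D))"
      unfolding diff
    proof (intro order_trans[OF norm_sum] sum_mono norm_triangle_le add_mono)
      fix V assume V: "V \<in> L"
      have "norm (T V (\<lambda>i. y i - y' i)) \<le> 2 * D * \<rho>"
        using D \<rho>(1) by (intro order_trans[OF T[OF V]] mult_left_mono) auto
      then show "norm (h V y *\<^sub>R T V (\<lambda>i. y i - y' i)) \<le> h V y * (2 * D * \<rho>)"
        using h0[of V y] by (simp add: mult_left_mono)
      have "norm (T V y') \<le> 2 * D * 1"
        using D y'1 by (intro order_trans[OF T[OF V]] mult_left_mono) auto
      then show "norm ((h V y - h V y') *\<^sub>R T V y') \<le> \<bar>h V y - h V y'\<bar> * (2 * D)"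
        by (simp add: mult_left_mono)
    qed
    also have "\<dots> = (\<Sum>V\<in>L. h V y) * (2 * D * \<rho>) + (\<Sum>V\<in>L. \<bar>h V y - h V y'\<bar>) * (2 * D)"
      by (simp only: sum.distrib sum_distrib_right)
    also have "\<dots> \<le> 1 * (2 * D * \<rho>) + (s * \<rho>) * (2 * D)"
    proof (intro add_mono mult_right_mono)
      show "(\<Sum>V\<in>L. h V y) \<le> 1"
        unfolding h_def by (rule hats_variation(1)[where \<tau> = \<tau>, OF L I s sep'])
      have "(\<Sum>V\<in>L. \<bar>h V y - h V y'\<bar>) \<le> s * linf I (\<lambda>i. y i - y' i)"
        unfolding h_def by (rule hats_variation(2)[where \<tau> = \<tau>, OF L I s sep'])
      also have "\<dots> \<le> s * \<rho>"
        using s \<rho>(2) by (rule mult_left_mono[rotated])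
      finally show "(\<Sum>V\<in>L. \<bar>h V y - h V y'\<bar>) \<le> s * \<rho>" .
    qed (use D \<rho>0 in auto)
    also have "\<dots> = 2 * D * (1 + s) * \<rho>"
      by (simp add: algebra_simps)
    also have "\<dots> \<le> \<gamma> * \<rho>"
      using \<gamma> \<rho>0 by (rule mult_right_mono)
    finally show "norm (\<Phi> y - \<Phi> y') \<le> \<gamma> * \<nu> (\<lambda>i. y i - y' i)"
      by (simp add: \<rho>_def)
  qed
  moreover have "(SUP f\<in>K. INF y\<in>unit_ball_Rk (n + m) \<nu>. ennreal (norm (f - \<Phi> y))) \<le>
      (SUP f\<in>K. INF V\<in>L. ennreal (infdist f V))"
  proof (rule SUP_subset_mono[OF subset_refl], rule INF_greatest)
    fix f V assume f: "f \<in> K" and V: "V \<in> L"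
    show "(INF y\<in>unit_ball_Rk (n + m) \<nu>. ennreal (norm (f - \<Phi> y))) \<le> ennreal (infdist f V)"
    proof (rule ennreal_le_epsilon)
      fix e :: real assume e: "0 < e"
      obtain x where x: "x \<in> V" "norm x \<le> 2" "norm (f - x) < infdist f V + e"
        using near_best_approximation[OF zero[OF V] K[OF f] e] by blast
      obtain a where a: "(\<Sum>i<n. a i *\<^sub>R v V i) = x" "L2_set a {..<n} \<le> D * norm x"
        using v[OF V] x(1) unfolding euclidean_frame_def by blast
      define y where "y i = (if i < n then 1 / (2 * D) * a i else if i < n + m then \<tau> V i else 0)" for i
      have "L2_set y {..<n} = L2_set (\<lambda>i. 1 / (2 * D) * a i) {..<n}"
        by (rule L2_set_cong) (auto simp: y_def)
      also have "\<dots> = 1 / (2 * D) * L2_set a {..<n}"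
        using D by (simp only: L2_set_scale) simp
      also have "\<dots> \<le> 1 / (2 * D) * (D * 2)"
        using D x(2) by (intro mult_left_mono order_trans[OF a(2)]) auto
      also have "\<dots> = 1"
        using D by simp
      finally have "L2_set y {..<n} \<le> 1" .
      moreover have y\<tau>: "y i = \<tau> V i" if "i \<in> I" for i
        using that by (simp add: y_def I_def)
      then have "linf I y \<le> 1"
        using I \<tau>[OF V] by (simp add: linf_le_iff)
      ultimately have y: "y \<in> unit_ball_Rk (n + m) \<nu>"
        by (auto simp: unit_ball_Rk_def Rk_def y_def \<nu>_def cylinder_norm_def I_def)
      have dist: "linf I (\<lambda>i. y i - \<tau> W i) = linf I (\<lambda>i. \<tau> V i - \<tau> W i)" for W
        by (rule linf_cong) (simp add: y\<tau>)
      have "linf I (\<lambda>i. \<tau> V i - \<tau> V i) = 0"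
        using linf_scale[OF I, of 0 y] by simp
      then have "h V y = 1"
        by (simp add: h_def hat_def dist)
      moreover have "h W y = 0" if "W \<in> L" "W \<noteq> V" for W
        using sep'[OF V that(1)] that(2) by (auto simp: h_def hat_def dist)
      ultimately have "\<Phi> y = T V y"
        unfolding \<Phi>_def using L V by (subst sum.remove[of _ V]) auto
      also have "\<dots> = (\<Sum>i<n. a i *\<^sub>R v V i)"
        using D by (simp add: T_def y_def scaleR_sum_right)
      finally have "\<Phi> y = x"
        using a(1) by simp
      then have "(INF y\<in>unit_ball_Rk (n + m) \<nu>. ennreal (norm (f - \<Phi> y))) \<le> ennreal (norm (f - x))"
        using y by (intro INF_lower2[of y]) auto
      also have "\<dots> \<le> ennreal (infdist f V + e)"
        using x(3) by (intro ennreal_leI) simp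
      finally show "(INF y\<in>unit_ball_Rk (n + m) \<nu>. ennreal (norm (f - \<Phi> y))) \<le>
          ennreal (infdist f V) + ennreal e"
        using e by (simp add: ennreal_plus infdist_nonneg)
    qed
  qed
  ultimately have "fixed_lipschitz_width \<gamma> (n + m) \<nu> K \<le> (SUP f\<in>K. INF V\<in>L. ennreal (infdist f V))"
    unfolding fixed_lipschitz_width_def by (rule INF_lower2[where i = \<Phi>])
  moreover have "\<nu> \<in> {\<nu>. norm_on_Rk (n + m) \<nu>}"
    by (simp add: \<nu>_def norm_on_Rk_cylinder_norm)
  ultimately have "(INF \<nu>\<in>{\<nu>. norm_on_Rk (n + m) \<nu>}. fixed_lipschitz_width \<gamma> (n + m) \<nu> K) \<le>
      (SUP f\<in>K. INF V\<in>L. ennreal (infdist f V))"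
    by (rule INF_lower2[where i = \<nu>, rotated])
  then show ?thesis
    unfolding lipschitz_width_def using n by (intro INF_lower2[of "n + m"]) auto
qed

text \<open>
  The two estimates differ in where the centres of the hats are placed: one extra coordinate holds
  \<open>M \<le> N\<close> equally spaced points, with spacing \<open>2/M\<close>; a cube of dimension \<open>\<lceil>log\<^sub>2 N\<rceil>\<close> has at least \<open>N\<close>
  corners, at mutual distance \<open>2\<close>.
\<close>

lemma lipschitz_widths_le_kolmogorov_width:
  fixes K :: "'a::real_normed_vector set"
  assumes n: "n \<ge> 1" and D: "D > 0" and K: "\<And>f. f \<in> K \<Longrightarrow> norm f \<le> 1"
    and frames: "\<And>V :: 'a set. subspace V \<Longrightarrow> dim V = n \<Longrightarrow> \<exists>v. euclidean_frame n D V v"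
  shows "lipschitz_width (2 * (N + 1) * D) (n + 1) K \<le> kolmogorov_width n N K"
    and "lipschitz_width (6 * D) (n + nat \<lceil>log 2 N\<rceil>) K \<le> kolmogorov_width n N K"
proof -
  show "lipschitz_width (2 * (N + 1) * D) (n + 1) K \<le> kolmogorov_width n N K"
    unfolding kolmogorov_width_def
  proof (rule INF_greatest)
    fix L :: "'a set set"
    assume "L \<in> {L. finite L \<and> real (card L) \<le> N \<and> (\<forall>V\<in>L. subspace V \<and> dim V = n)}"
    then have L: "finite L" "real (card L) \<le> N" and V: "\<And>V. V \<in> L \<Longrightarrow> subspace V \<and> dim V = n"
      by auto
    define M where "M = card L"
    obtain e where e: "bij_betw e L {0..<M}"
      using ex_bij_betw_finite_nat[OF L(1)] by (auto simp: M_def)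
    then have e_less: "e V < M" if "V \<in> L" for V
      using that by (auto dest: bij_betwE)
    define \<tau> :: "'a set \<Rightarrow> nat \<Rightarrow> real" where "\<tau> V i = - 1 + 2 * e V / M" for V i
    show "lipschitz_width (2 * (N + 1) * D) (n + 1) K \<le> (SUP f\<in>K. INF V\<in>L. ennreal (infdist f V))"
    proof (rule lipschitz_width_le_glued[where D = D and s = "real M" and \<tau> = \<tau>, OF n L(1) D])
      show "\<bar>\<tau> V i\<bar> \<le> 1" if "V \<in> L" for V i
        using e_less[OF that] by (simp add: \<tau>_def abs_le_iff divide_le_eq)
      show "2 \<le> real M * linf {n..<n + 1} (\<lambda>i. \<tau> V i - \<tau> W i)" if "V \<in> L" "W \<in> L" "V \<noteq> W" for V W
      proof -
        have M: "real M > 0"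
          using e_less[OF that(1)] by simp
        have "e V \<noteq> e W"
          using e that by (auto simp: bij_betw_def inj_on_def)
        define \<delta> where "\<delta> = real (e V) - real (e W)"
        have "1 \<le> \<bar>\<delta>\<bar>"
          unfolding \<delta>_def using \<open>e V \<noteq> e W\<close> by linarith
        moreover have "\<tau> V n - \<tau> W n = 2 * \<delta> / M"
          by (simp add: \<tau>_def \<delta>_def diff_divide_distrib right_diff_distrib)
        then have "real M * \<bar>\<tau> V n - \<tau> W n\<bar> = 2 * \<bar>\<delta>\<bar>"
          using M by (simp add: abs_mult)
        ultimately have "2 \<le> real M * \<bar>\<tau> V n - \<tau> W n\<bar>"
          by linarith
        moreover have "\<bar>\<tau> V n - \<tau> W n\<bar> \<le> linf {n..<n + 1} (\<lambda>i. \<tau> V i - \<tau> W i)"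
          using abs_le_linf[of "{n..<n + 1}" n "\<lambda>i. \<tau> V i - \<tau> W i"] by simp
        ultimately show ?thesis
          using M by (meson less_imp_le mult_left_mono order_trans)
      qed
      have "2 * D * (1 + real M) \<le> 2 * D * (N + 1)"
        using D L(2) by (intro mult_left_mono) (auto simp: M_def)
      then show "2 * D * (1 + real M) \<le> 2 * (N + 1) * D"
        by (simp add: mult_ac)
    qed (use V frames K in \<open>auto intro: subspace_0\<close>)
  qed
  show "lipschitz_width (6 * D) (n + nat \<lceil>log 2 N\<rceil>) K \<le> kolmogorov_width n N K"
    unfolding kolmogorov_width_def
  proof (rule INF_greatest)
    fix L :: "'a set set"
    assume "L \<in> {L. finite L \<and> real (card L) \<le> N \<and> (\<forall>V\<in>L. subspace V \<and> dim V = n)}"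
    then have L: "finite L" "real (card L) \<le> N" and V: "\<And>V. V \<in> L \<Longrightarrow> subspace V \<and> dim V = n"
      by auto
    define m where "m = nat \<lceil>log 2 N\<rceil>"
    have "real (card L) \<le> 2 ^ m"
    proof (cases "N > 0")
      case True
      then have "N = 2 powr log 2 N"
        by simp
      also have "\<dots> \<le> 2 powr real m"
        unfolding m_def by (intro powr_mono real_nat_ceiling_ge) auto
      finally have "N \<le> 2 ^ m"
        by (simp add: powr_realpow)
      with L(2) show ?thesis
        by (rule order_trans)
    qed (use L(2) in \<open>auto intro: order_trans[of _ 0]\<close>)
    then have "real (card L) \<le> real (card (Pow {n..<n + m}))"
      by (simp add: card_Pow)
    then have "card L \<le> card (Pow {n..<n + m})"
      by (simp only: of_nat_le_iff)
    then obtain c where c: "c ` L \<subseteq> Pow {n..<n + m}" "inj_on c L"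
      using card_le_inj[OF L(1)] by blast
    define \<tau> :: "'a set \<Rightarrow> nat \<Rightarrow> real" where "\<tau> V i = (if i \<in> c V then 1 else - 1)" for V i
    show "lipschitz_width (6 * D) (n + m) K \<le> (SUP f\<in>K. INF V\<in>L. ennreal (infdist f V))"
    proof (rule lipschitz_width_le_glued[where D = D and s = 1 and \<tau> = \<tau>, OF n L(1) D])
      show "2 \<le> 1 * linf {n..<n + m} (\<lambda>i. \<tau> V i - \<tau> W i)" if VW: "V \<in> L" "W \<in> L" "V \<noteq> W" for V W
      proof -
        have "c V \<noteq> c W"
          using VW c(2) by (auto dest: inj_onD)
        then obtain i where i: "i \<in> c V \<longleftrightarrow> i \<notin> c W"
          by blast
        then have "i \<in> {n..<n + m}"
          using VW c(1) by blast
        from abs_le_linf[OF _ this, of "\<lambda>i. \<tau> V i - \<tau> W i"] show ?thesis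
          using i by (auto simp: \<tau>_def split: if_splits)
      qed
    qed (use V frames K D in \<open>auto simp: \<tau>_def intro: subspace_0\<close>)
  qed
qed

theorem lemma3p5:
  fixes K :: "'a::banach set" and n :: nat and N :: real
  assumes "n \<ge> 1" and "N > 1"
    and "compact K" and "K \<noteq> {}" and "(SUP f\<in>K. norm f) = 1"
  shows
    "lipschitz_width (2 * (N + 1) * sqrt (real n)) (n + 1) K \<le> kolmogorov_width n N K \<and>
     lipschitz_width (6 * sqrt (real n)) (n + nat \<lceil>log 2 N\<rceil>) K \<le> kolmogorov_width n N K \<and>
     (\<forall>(p :: ennreal) (M :: 'b measure) (J :: 'a \<Rightarrow> 'b \<Rightarrow> real).
        1 \<le> p \<and> is_Lp_space p M J \<longrightarrow>
          lipschitz_width (2 * (N + 1) * real n powr Lp_exponent p) (n + 1) K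
            \<le> kolmogorov_width n N K \<and>
          lipschitz_width (6 * real n powr Lp_exponent p) (n + nat \<lceil>log 2 N\<rceil>) K
            \<le> kolmogorov_width n N K)"
proof (intro conjI allI impI)
  have n: "n \<ge> 1"
    by fact
  have K: "norm f \<le> 1" if "f \<in> K" for f
  proof -
    have "compact (norm ` K)"
      by (intro compact_continuous_image continuous_intros assms)
    then have "bdd_above (norm ` K)"
      by (intro bounded_imp_bdd_above compact_imp_bounded)
    then show ?thesis
      using cSUP_upper[OF that] assms(5) by metis
  qed
  note widths = lipschitz_widths_le_kolmogorov_width[OF n _ K]
  show "lipschitz_width (2 * (N + 1) * sqrt (real n)) (n + 1) K \<le> kolmogorov_width n N K"
    and "lipschitz_width (6 * sqrt (real n)) (n + nat \<lceil>log 2 N\<rceil>) K \<le> kolmogorov_width n N K"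
    using n by (intro widths john_euclidean_frame; simp)+
  fix p and M :: "'b measure" and J :: "'a \<Rightarrow> 'b \<Rightarrow> real"
  assume "1 \<le> p \<and> is_Lp_space p M J"
  then have p: "1 \<le> p" and J: "is_Lp_space p M J"
    by auto
  have frame: "\<exists>v. euclidean_frame n (real n powr Lp_exponent p) V v"
    if dim: "dim V = n" for V :: "'a set"
  proof (cases "p = \<infinity>")
    case True
    then have "real n powr Lp_exponent p = sqrt n"
      by (simp add: Lp_exponent_def powr_half_sqrt)
    then show ?thesis
      using john_euclidean_frame[OF dim n] by simp
  next
    case False
    define q where "q = enn2real p"
    have pq: "p = ennreal q"
      using False by (simp add: q_def less_top)
    have q: "1 \<le> q"
      using p unfolding pq by simp
    interpret Lq_space q M J
      using q J by unfold_locales (simp_all add: pq)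
    have "1 / p = ennreal (1 / q)"
      using q unfolding pq by (simp add: divide_ennreal flip: ennreal_1)
    then have "Lp_exponent p = \<bar>1 / 2 - 1 / q\<bar>"
      using q by (simp add: Lp_exponent_def)
    then show ?thesis
      using lewis_euclidean_frame[OF dim n] by simp
  qed
  show "lipschitz_width (2 * (N + 1) * real n powr Lp_exponent p) (n + 1) K \<le> kolmogorov_width n N K"
    and "lipschitz_width (6 * real n powr Lp_exponent p) (n + nat \<lceil>log 2 N\<rceil>) K \<le> kolmogorov_width n N K"
    using n frame by (intro widths; simp)+
qed

end
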